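(* Let $\mathscr{M}=(X,\mathcal I)$ and $\mathscr{N}=(Y,\mathcal J)$ be matroids, let $n=|X|$, and let $\Phi:\mathscr M\to\mathscr N$ be a morphism of matroids. Let $\omega:X\to\mathbb R_{>0}$ be a positive weight function and let $1\le k<\mathrm{rk}(\mathscr M)$. Suppose $\mathrm B_\omega(k)>0$. Then $$\mathrm B_\omega(k)^2\ =\ \Bigl(1+\frac1k\Bigr)\Bigl(1+\frac{1}{n-k}\Bigr)\,\mathrm B_\omega(k-1)\,\mathrm B_\omega(k+1)$$ if and only if $\mathrm{girth}(\mathscr M)>k+1$, the weight function $\omega$ is uniform (constant on $X$), and $g(\Phi(S))=\mathrm{rk}(\mathscr N)$ for all $S\in\mathcal I_{k-1}$, where $g$ is the rank function of $\mathscr N$.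
   Context: Matroids are finite, given by ground set and independent sets; $\mathcal I_j=\{S\in\mathcal I:|S|=j\}$. The rank functions of $\mathscr M$ and $\mathscr N$ are $f(S)=\max\{|A|:A\subseteq S, A\in\mathcal I\}$ for $S\subseteq X$, and $g$ defined likewise on subsets of $Y$; $\mathrm{rk}(\mathscr M)=f(X)$, $\mathrm{rk}(\mathscr N)=g(Y)$. A morphism $\Phi:\mathscr M\to\mathscr N$ is a function $\Phi:X\to Y$ with $g(\Phi(T))-g(\Phi(S))\le f(T)-f(S)$ for all $S\subseteq T\subseteq X$. A set $S\in\mathcal I$ is a basis of $\Phi$ if $g(\Phi(S))=\mathrm{rk}(\mathscr N)$. Let $\mathcal B_j$ be the set of bases of $\Phi$ of size $j$. Put $\omega(S)=\prod_{x\in S}\omega(x)$ and $\mathrm B_\omega(j)=\sum_{S\in\mathcal B_j}\omega(S)$. The girth is $\mathrm{girth}(\mathscr M)=\min\{j: |\mathcal I_j|<\binom{n}{j}\}$, i.e. the size of the smallest circuit of $\mathscr M$, with $\min\varnothing=\infty$. *)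

theory Defs
  imports Complex_Main "HOL-Library.Extended_Nat" "HOL-Library.FuncSet"
begin

locale matroid =
  fixes X :: "'a set" and I :: "'a set set"
  assumes finite_ground: "finite X"
    and indep_subset_ground: "S \<in> I \<Longrightarrow> S \<subseteq> X"
    and indep_empty: "{} \<in> I"
    and indep_hereditary: "S \<in> I \<Longrightarrow> A \<subseteq> S \<Longrightarrow> A \<in> I"
    and indep_augment: "A \<in> I \<Longrightarrow> B \<in> I \<Longrightarrow> card A < card B \<Longrightarrow> \<exists>x\<in>B - A. insert x A \<in> I"

definition indep_of_size :: "'a set set \<Rightarrow> nat \<Rightarrow> 'a set set" where
  "indep_of_size I j = {S \<in> I. card S = j}"

definition rank_fun :: "'a set set \<Rightarrow> 'a set \<Rightarrow> nat" where
  "rank_fun I S = Max {card A | A. A \<subseteq> S \<and> A \<in> I}"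

text \<open>The infimum in \<open>enat\<close> is the minimum of a nonempty set, and \<open>\<infinity>\<close> for the empty set.\<close>

definition girth :: "'a set \<Rightarrow> 'a set set \<Rightarrow> enat" where
  "girth X I = Inf (enat ` {j. card (indep_of_size I j) < (card X choose j)})"

text \<open>The rank differences are taken in the integers, so that subtraction does not truncate.\<close>

definition matroid_morphism ::
    "'a set \<Rightarrow> 'a set set \<Rightarrow> 'b set \<Rightarrow> 'b set set \<Rightarrow> ('a \<Rightarrow> 'b) \<Rightarrow> bool" where
  "matroid_morphism X I Y J \<Phi> \<longleftrightarrow>
     \<Phi> \<in> X \<rightarrow> Y \<and>
     (\<forall>S T. S \<subseteq> T \<longrightarrow> T \<subseteq> X \<longrightarrow>
        int (rank_fun J (\<Phi> ` T)) - int (rank_fun J (\<Phi> ` S))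
          \<le> int (rank_fun I T) - int (rank_fun I S))"

definition morphism_bases ::
    "'a set set \<Rightarrow> 'b set \<Rightarrow> 'b set set \<Rightarrow> ('a \<Rightarrow> 'b) \<Rightarrow> nat \<Rightarrow> 'a set set" where
  "morphism_bases I Y J \<Phi> j =
     {S \<in> indep_of_size I j. rank_fun J (\<Phi> ` S) = rank_fun J Y}"

definition weighted_bases ::
    "'a set set \<Rightarrow> 'b set \<Rightarrow> 'b set set \<Rightarrow> ('a \<Rightarrow> 'b) \<Rightarrow> ('a \<Rightarrow> real) \<Rightarrow> nat \<Rightarrow> real" where
  "weighted_bases I Y J \<Phi> \<omega> j = (\<Sum>S\<in>morphism_bases I Y J \<Phi> j. \<Prod>x\<in>S. \<omega> x)"

end

(*
  The bases of a morphism form an exchange family that is closed under passing to links.  Attach to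
  such a family B on X the homogeneous polynomial P of degree m, the sum over S in B of
  w^S z^(m - |S|), where m is at least the number of elements.  Up to constants, its derivative along
  x in X is the polynomial of the link of x, with m - 1 in place of m, and its derivative along z
  truncates the family.  Evaluating all but two of the arguments of the polarization of P at the
  weight vector gives symmetric forms that have at most one positive eigenvalue.  This propagates
  from links to the whole family by a Bochner type inequality: an eigenvector orthogonal to the
  weight vector with a positive eigenvalue l (normalised so that the weight vector has eigenvalue 1)
  satisfies l^2 >= l, hence l >= 1, which contradicts connectedness of the form.  The base case is
  a quadratic form of a complete multipartite graph.

  In the equality case the form of degree k + 1 degenerates on the plane spanned by the weight
  vector and the z-direction, so a vector (w, -l) lies in its kernel.  The same vector then lies in
  the kernel of the form of every link, with the same l, down to the links of the (k - 1)-sets.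
  There the kernel equations say that each parallel class has weight l and that the number of
  classes is the number of remaining elements.
*)

theory Submission
  imports Defs "HOL-Analysis.Analysis"
begin

section \<open>Forms with at most one positive eigenvalue\<close>

text \<open>Why \<open>m\<close> is at least the number of elements: after \<open>e\<close>
  derivatives along z, the quadratic forms at the bottom have z-entries built from
  \<open>e + 1\<close> and \<open>(e + 1) * (e + 2)\<close>, and the bound of at most
  \<open>e + 2\<close> classes guarantees that they have at most one positive eigenvalue. Every
  derivative lowers the degree by one and either removes an element or raises \<open>e\<close>, so
  \<open>m >= |X|\<close> is exactly what delivers this bound. The same entries produce the constant
  of the theorem: with \<open>m = n\<close>, \<open>d = k - 1\<close> and
  \<open>e = n - k - 1\<close>, the determinant on the plane of the weight vector and the
  z-direction compares \<open>(d + 1) * (e + 1)\<close> with \<open>(d + 2) * (e + 2)\<close>. The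
  obstacle is the weight \<open>t\<close> of z. The eigenvector argument needs strictly positive
  weights, but single levels of the family are visible only at \<open>t = 0\<close>. Hence the
  eigenvalue bound is proved for \<open>t > 0\<close> and carried to the limit, whereas the equality
  case has to run at \<open>t = 0\<close> itself, where z has weight zero and the forms of some
  links may vanish.\<close>

definition bilin :: "'i set \<Rightarrow> ('i \<Rightarrow> 'i \<Rightarrow> real) \<Rightarrow> ('i \<Rightarrow> real) \<Rightarrow> ('i \<Rightarrow> real) \<Rightarrow> real" where
  "bilin V H u v = (\<Sum>i\<in>V. u i * (\<Sum>j\<in>V. H i j * v j))"

text \<open>For a symmetric form on a finite index set, this reversed Cauchy-Schwarz inequality is
  equivalent to having at most one positive eigenvalue. It needs no spectral theory, is closed under
  limits, and is the inequality that is applied to the forms of links.\<close>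

definition hyperbolic :: "'i set \<Rightarrow> ('i \<Rightarrow> 'i \<Rightarrow> real) \<Rightarrow> bool" where
  "hyperbolic V H \<longleftrightarrow>
     (\<forall>u v. bilin V H u u > 0 \<longrightarrow> bilin V H u u * bilin V H v v \<le> (bilin V H u v)\<^sup>2)"

lemma bilin_left: "bilin V H (\<lambda>i. a * u i + b * v i) w = a * bilin V H u w + b * bilin V H v w"
  by (simp add: bilin_def sum.distrib sum_distrib_left algebra_simps)

lemma bilin_right: "bilin V H w (\<lambda>i. a * u i + b * v i) = a * bilin V H w u + b * bilin V H w v"
  by (simp add: bilin_def sum.distrib sum_distrib_left algebra_simps)

lemma bilin_commute:
  assumes "\<And>i j. H i j = H j i"
  shows "bilin V H u v = bilin V H v u"
proof -
  have "bilin V H u v = (\<Sum>i\<in>V. \<Sum>j\<in>V. H i j * u i * v j)"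
    by (simp add: bilin_def sum_distrib_left mult_ac)
  also have "\<dots> = (\<Sum>j\<in>V. \<Sum>i\<in>V. H i j * u i * v j)" by (rule sum.swap)
  also have "\<dots> = bilin V H v u"
    by (simp add: bilin_def sum_distrib_left mult_ac assms)
  finally show ?thesis .
qed

lemma bilin_quad:
  fixes H :: "'i \<Rightarrow> 'i \<Rightarrow> real"
  assumes "\<And>i j. H i j = H j i"
  shows "bilin V H (\<lambda>i. a * u i + b * v i) (\<lambda>i. a * u i + b * v i)
           = a\<^sup>2 * bilin V H u u + 2 * a * b * bilin V H u v + b\<^sup>2 * bilin V H v v"
  by (simp add: bilin_left bilin_right bilin_commute[where H=H and u=v and v=u, OF assms] power2_eq_square algebra_simps)

text \<open>A vector \<open>u\<close> with positive value is not orthogonal to \<open>W\<close>, so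
  subtracting a multiple of \<open>u\<close> makes any \<open>v\<close> orthogonal to
  \<open>W\<close>. The value there is nonpositive, and completing the square gives the
  inequality.\<close>

lemma hyperbolicI_perp:
  assumes sym: "\<And>i j. H i j = H j i"
    and perp: "\<And>v. bilin V H v W = 0 \<Longrightarrow> bilin V H v v \<le> 0"
  shows "hyperbolic V H"
  unfolding hyperbolic_def
proof (intro allI impI)
  fix u v
  assume u: "bilin V H u u > 0"
  then have nz: "bilin V H u W \<noteq> 0" using perp[of u] by auto
  define l where "l = bilin V H v W / bilin V H u W"
  have "bilin V H (\<lambda>i. 1 * v i + (- l) * u i) W = 0"
    unfolding bilin_left l_def using nz by simp
  from perp[OF this]
  have le: "bilin V H v v - 2 * l * bilin V H u v + l\<^sup>2 * bilin V H u u \<le> 0"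
    unfolding bilin_quad[OF sym] by (simp add: bilin_commute[where H=H and u=v and v=u, OF sym])
  have "bilin V H u u * (bilin V H v v - 2 * l * bilin V H u v + l\<^sup>2 * bilin V H u u) \<le> 0"
    using u le by (simp add: mult_le_0_iff)
  moreover have "0 \<le> (bilin V H u v - l * bilin V H u u)\<^sup>2" by simp
  ultimately show "bilin V H u u * bilin V H v v \<le> (bilin V H u v)\<^sup>2"
    by (simp add: power2_eq_square algebra_simps)
qed

text \<open>A product of two linear functionals has at most one positive eigenvalue, and a symmetric
  form lying below it inherits this. It replaces diagonalisation in the quadratic case.\<close>

lemma hyperbolicI_product:
  assumes sym: "\<And>i j. H i j = H j i"
    and L1: "\<And>a b u v. L1 (\<lambda>i. a * u i + b * v i) = a * L1 u + b * (L1 v :: real)"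
    and L2: "\<And>a b u v. L2 (\<lambda>i. a * u i + b * v i) = a * L2 u + b * (L2 v :: real)"
    and le: "\<And>v. bilin V H v v \<le> L1 v * L2 v"
  shows "hyperbolic V H"
  unfolding hyperbolic_def
proof (intro allI impI)
  fix u v
  assume u: "bilin V H u u > 0"
  then have pos: "L1 u * L2 u > 0" using le[of u] by linarith
  \<comment> \<open>With this \<open>l\<close>, the ratios \<open>L1 / L1 u\<close> and
    \<open>L2 / L2 u\<close> at \<open>v + l * u\<close> are opposite numbers; as
    \<open>L1 u * L2 u > 0\<close>, the product is nonpositive there.\<close>
  define l where "l = - (L1 v + (L1 u / L2 u) * L2 v) / (2 * L1 u)"
  have nz: "L1 u \<noteq> 0" "L2 u \<noteq> 0" using pos by auto
  let ?w = "\<lambda>i. 1 * v i + l * u i"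
  have "L1 ?w = - (L1 u / L2 u) * L2 ?w"
    unfolding L1 L2 l_def using nz by (simp add: field_simps)
  then have "L1 ?w * L2 ?w = - ((L1 u * L2 u) * (L2 ?w / L2 u)\<^sup>2)"
    using nz by (simp add: power2_eq_square)
  also have "\<dots> \<le> 0" using pos by simp
  finally have "bilin V H ?w ?w \<le> 0" using le[of ?w] by linarith
  then have le: "bilin V H v v + 2 * l * bilin V H u v + l\<^sup>2 * bilin V H u u \<le> 0"
    unfolding bilin_quad[OF sym] by (simp add: bilin_commute[where H=H and u=v and v=u, OF sym])
  have "bilin V H u u * (bilin V H v v + 2 * l * bilin V H u v + l\<^sup>2 * bilin V H u u) \<le> 0"
    using u le by (simp add: mult_le_0_iff)
  moreover have "0 \<le> (bilin V H u v + l * bilin V H u u)\<^sup>2" by simp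
  ultimately show "bilin V H u u * bilin V H v v \<le> (bilin V H u v)\<^sup>2"
    by (simp add: power2_eq_square algebra_simps)
qed

text \<open>A strictly positive value at \<open>t = 0\<close> stays positive for small
  \<open>t > 0\<close>, and the weak inequality passes to the limit.\<close>

lemma hyperbolic_limit:
  assumes hyp: "\<And>t. t > 0 \<Longrightarrow> hyperbolic V (H t)"
    and lim: "\<And>i j. ((\<lambda>t. H t i j) \<longlongrightarrow> H 0 i j) (at_right (0::real))"
  shows "hyperbolic V (H 0)"
  unfolding hyperbolic_def
proof (intro allI impI)
  fix u v
  assume pos: "bilin V (H 0) u u > 0"
  have lim': "((\<lambda>t. bilin V (H t) x y) \<longlongrightarrow> bilin V (H 0) x y) (at_right 0)" for x y
    unfolding bilin_def by (intro tendsto_intros lim)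
  have "eventually (\<lambda>t. bilin V (H t) u u > 0) (at_right 0)"
    using order_tendstoD(1)[OF lim' pos] .
  moreover have "eventually (\<lambda>t. t > (0::real)) (at_right 0)"
    by (simp add: eventually_at_right_less)
  ultimately have ev: "eventually (\<lambda>t. bilin V (H t) u u * bilin V (H t) v v \<le> (bilin V (H t) u v)\<^sup>2) (at_right 0)"
    by eventually_elim (use hyp in \<open>auto simp: hyperbolic_def\<close>)
  show "bilin V (H 0) u u * bilin V (H 0) v v \<le> (bilin V (H 0) u v)\<^sup>2"
    by (rule tendsto_le[OF _ _ _ ev]) (auto intro!: tendsto_intros lim')
qed

section \<open>A variational eigenvector and the passage from local forms to the global form\<close>

lemma linear_coeff_zero:
  fixes r s :: real
  assumes "\<And>e. 0 \<le> 2 * e * r + e\<^sup>2 * s"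
  shows "r = 0"
proof (rule ccontr)
  assume r: "r \<noteq> 0"
  \<comment> \<open>The denominator is nonzero and large enough that the quadratic term cannot
    compensate the linear one.\<close>
  define e where "e = - r / (\<bar>s\<bar> + 1)"
  have "0 \<le> (\<bar>s\<bar> + 1)\<^sup>2 * (2 * e * r + e\<^sup>2 * s)" using assms by simp
  also have "\<dots> = r\<^sup>2 * (s - 2 * (\<bar>s\<bar> + 1))"
    unfolding e_def by (simp add: power2_eq_square divide_simps) (simp add: algebra_simps)
  also have "\<dots> < 0" using r by (intro mult_pos_neg) auto
  finally show False by simp
qed

text \<open>Compactness stands in for the spectral theorem: the Rayleigh quotient of
  \<open>H\<close> with respect to the weights \<open>d\<close> attains its maximum on the
  hyperplane orthogonal to \<open>p\<close>. The vector \<open>x\<close> makes this maximum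
  positive.\<close>

lemma rayleigh_maximizer:
  fixes H :: "'i \<Rightarrow> 'i \<Rightarrow> real" and d p :: "'i \<Rightarrow> real"
  assumes fin: "finite A" and d: "\<And>i. i \<in> A \<Longrightarrow> d i > 0"
    and x: "(\<Sum>i\<in>A. p i * x i) = 0" "bilin A H x x > 0"
  obtains v l where "(\<Sum>i\<in>A. p i * v i) = 0" "(\<Sum>i\<in>A. d i * (v i)\<^sup>2) = 1" "l > 0" "bilin A H v v = l"
    "\<And>u. (\<Sum>i\<in>A. p i * u i) = 0 \<Longrightarrow> bilin A H u u \<le> l * (\<Sum>i\<in>A. d i * (u i)\<^sup>2)"
proof -
  \<comment> \<open>Vectors are functions on the whole index type; pinning the coordinates outside
    \<open>A\<close> to zero makes the box compact in the product topology. The bound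
    \<open>1 + 1 / d i\<close> is a root-free consequence of
    \<open>d i * (v i)^2 <= 1\<close>.\<close>
  define box where "box = PiE UNIV (\<lambda>i. if i \<in> A then {- (1 + 1 / d i) .. 1 + 1 / d i} else {0::real})"
  define K where "K = box \<inter> {v. (\<Sum>i\<in>A. p i * v i) = 0} \<inter> {v. (\<Sum>i\<in>A. d i * (v i)\<^sup>2) = 1}"
  define N where "N u = (\<Sum>i\<in>A. d i * (u i)\<^sup>2)" for u
  have "compactin (product_topology (\<lambda>i. euclidean) UNIV) box"
    unfolding box_def compactin_PiE by auto
  then have "compact box"
    by (simp add: euclidean_product_topology)
  moreover have "closed {v. (\<Sum>i\<in>A. p i * v i) = 0}"
    by (intro closed_Collect_eq continuous_intros continuous_on_product_coordinates)
  moreover have "closed {v. (\<Sum>i\<in>A. d i * (v i)\<^sup>2) = 1}"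
    by (intro closed_Collect_eq continuous_intros continuous_on_product_coordinates)
  ultimately have K: "compact K"
    unfolding K_def by (intro compact_Int_closed)
  \<comment> \<open>Homogeneity: every vector of the hyperplane that is nonzero on \<open>A\<close>
    is, on \<open>A\<close>, a positive multiple of a point of \<open>K\<close>.\<close>
  have norm: "\<exists>v\<in>K. \<exists>c. c > 0 \<and> N u = c\<^sup>2 \<and> bilin A H u u = c\<^sup>2 * bilin A H v v"
    if u: "(\<Sum>i\<in>A. p i * u i) = 0" and nz: "\<exists>i\<in>A. u i \<noteq> 0" for u
  proof -
    define c where "c = sqrt (N u)"
    have Npos: "N u > 0"
    proof -
      obtain i where i: "i \<in> A" "u i \<noteq> 0" using nz by auto
      have "0 < d i * (u i)\<^sup>2" using i d by simp
      also have "\<dots> \<le> N u" unfolding N_def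
        by (rule member_le_sum) (use i d fin in \<open>auto simp: less_imp_le\<close>)
      finally show ?thesis .
    qed
    then have c: "c > 0" "c\<^sup>2 = N u" by (auto simp: c_def)
    define v where "v i = (if i \<in> A then u i / c else 0)" for i
    have "(\<Sum>i\<in>A. p i * v i) = (\<Sum>i\<in>A. p i * u i) / c"
      unfolding sum_divide_distrib by (rule sum.cong) (auto simp: v_def)
    then have v1: "(\<Sum>i\<in>A. p i * v i) = 0" using u by simp
    have "(\<Sum>i\<in>A. d i * (v i)\<^sup>2) = N u / c\<^sup>2"
      unfolding sum_divide_distrib N_def by (rule sum.cong) (auto simp: v_def power_divide)
    then have v2: "(\<Sum>i\<in>A. d i * (v i)\<^sup>2) = 1" using c Npos by simp
    have "v \<in> box"
      unfolding box_def
    proof (rule PiE_I)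
      fix i
      show "v i \<in> (if i \<in> A then {- (1 + 1 / d i) .. 1 + 1 / d i} else {0})"
      proof (cases "i \<in> A")
        case True
        have "d i * (v i)\<^sup>2 \<le> (\<Sum>i\<in>A. d i * (v i)\<^sup>2)"
          by (rule member_le_sum) (use True d fin in \<open>auto simp: less_imp_le\<close>)
        then have "(v i)\<^sup>2 \<le> 1 / d i" using v2 d[OF True] by (simp add: field_simps)
        moreover have "2 * \<bar>v i\<bar> \<le> 1 + (v i)\<^sup>2"
          using zero_le_power2[of "\<bar>v i\<bar> - 1"] by (simp add: power2_diff)
        ultimately have "\<bar>v i\<bar> \<le> 1 + 1 / d i" using d[OF True] zero_le_power2[of "v i"] by linarith
        then show ?thesis using True by auto
      qed (simp add: v_def)
    qed auto
    with v1 v2 have "v \<in> K" by (simp add: K_def)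
    moreover have "bilin A H u u = c\<^sup>2 * bilin A H v v"
      unfolding bilin_def sum_distrib_left
      using c by (intro sum.cong) (auto simp: v_def power2_eq_square)
    ultimately show ?thesis using c by (intro bexI[of _ v] exI[of _ c]) simp_all
  qed
  have "\<exists>i\<in>A. x i \<noteq> 0"
  proof (rule ccontr)
    assume "\<not> ?thesis"
    then have "bilin A H x x = 0" by (simp add: bilin_def)
    with x show False by simp
  qed
  from norm[OF x(1) this] obtain y c where y: "y \<in> K" "c > 0" "bilin A H x x = c\<^sup>2 * bilin A H y y"
    by blast
  have ypos: "bilin A H y y > 0" using y x(2) by (simp add: zero_less_mult_iff)
  have cont: "continuous_on K (\<lambda>v. bilin A H v v)"
    unfolding bilin_def
    by (intro continuous_intros continuous_on_subset[OF continuous_on_product_coordinates subset_UNIV])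
  obtain v where v: "v \<in> K" "\<And>w. w \<in> K \<Longrightarrow> bilin A H w w \<le> bilin A H v v"
    using continuous_attains_sup[OF K _ cont] y(1) by blast
  show ?thesis
  proof (rule that[of v "bilin A H v v"])
    show "0 < bilin A H v v" using v(2)[OF y(1)] ypos by linarith
    fix u assume u: "(\<Sum>i\<in>A. p i * u i) = 0"
    show "bilin A H u u \<le> bilin A H v v * (\<Sum>i\<in>A. d i * (u i)\<^sup>2)"
    proof (cases "\<exists>i\<in>A. u i \<noteq> 0")
      case True
      from norm[OF u True] obtain w c where w: "w \<in> K" "c > 0" "N u = c\<^sup>2" "bilin A H u u = c\<^sup>2 * bilin A H w w"
        by blast
      then show ?thesis using v(2)[OF w(1)] by (simp add: N_def mult.commute)
    next
      case False
      then show ?thesis by (simp add: bilin_def)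
    qed
  qed (use v(1) in \<open>auto simp: K_def\<close>)
qed

text \<open>In this and the following lemmas \<open>T\<close> stands for the third and
  \<open>H\<close> for the second derivatives of a homogeneous polynomial at the point
  \<open>W\<close>. The hypothesis is Euler's relation, with \<open>c\<close> the degree minus
  two.\<close>

lemma bilin_euler:
  assumes "\<And>i j. i \<in> V \<Longrightarrow> j \<in> V \<Longrightarrow> (\<Sum>l\<in>V. T i j l * W l) = c * H i j" and "i \<in> V"
  shows "bilin V (T i) u W = c * (\<Sum>j\<in>V. H i j * u j)"
  unfolding bilin_def sum_distrib_left
  by (intro sum.cong) (use assms in \<open>auto simp: sum_distrib_left[symmetric]\<close>)

lemma bilin_euler_sum:
  assumes symT: "\<And>i j l. T i j l = T i l j" "\<And>i j l. T i j l = T j i l"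
    and euler: "\<And>i j. i \<in> V \<Longrightarrow> j \<in> V \<Longrightarrow> (\<Sum>l\<in>V. T i j l * W l) = c * H i j"
  shows "(\<Sum>i\<in>V. W i * bilin V (T i) v v) = c * bilin V H v v"
proof -
  have "(\<Sum>i\<in>V. W i * bilin V (T i) v v) = (\<Sum>i\<in>V. \<Sum>j\<in>V. \<Sum>k\<in>V. T i j k * W i * v j * v k)"
    unfolding bilin_def by (simp add: sum_distrib_left mult_ac)
  also have "\<dots> = (\<Sum>j\<in>V. \<Sum>k\<in>V. \<Sum>i\<in>V. T i j k * W i * v j * v k)"
    by (subst sum.swap) (intro sum.cong refl sum.swap)
  also have "\<dots> = (\<Sum>j\<in>V. \<Sum>k\<in>V. (\<Sum>i\<in>V. T j k i * W i) * v j * v k)"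
  proof (intro sum.cong refl)
    fix j k
    show "(\<Sum>i\<in>V. T i j k * W i * v j * v k) = (\<Sum>i\<in>V. T j k i * W i) * v j * v k"
      unfolding sum_distrib_right by (intro sum.cong refl) (metis symT)
  qed
  also have "\<dots> = (\<Sum>j\<in>V. \<Sum>k\<in>V. c * H j k * v j * v k)"
    by (intro sum.cong refl) (simp add: euler)
  also have "\<dots> = c * bilin V H v v"
    by (simp add: bilin_def sum_distrib_left mult_ac)
  finally show ?thesis .
qed

text \<open>The set \<open>A\<close> of nonzero rows is where the weights
  \<open>d i = r i / W i\<close> are positive; they are the weights for which \<open>W\<close> has
  eigenvalue one. The hypothesis \<open>conn\<close> expresses connectedness through functions that
  are constant along positive entries. This avoids paths and asks only that indices of nonzero rows
  be joined.\<close>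

lemma hyperbolic_local_to_global:
  fixes T :: "'i \<Rightarrow> 'i \<Rightarrow> 'i \<Rightarrow> real"
  assumes fin: "finite V"
    and symH: "\<And>i j. H i j = H j i"
    and symT: "\<And>i j l. T i j l = T i l j" "\<And>i j l. T i j l = T j i l"
    and nonneg: "\<And>i j l. T i j l \<ge> 0"
    and W: "\<And>i. i \<in> V \<Longrightarrow> W i > 0"
    and c: "c > 0"
    and euler: "\<And>i j. i \<in> V \<Longrightarrow> j \<in> V \<Longrightarrow> (\<Sum>l\<in>V. T i j l * W l) = c * H i j"
    and hyp: "\<And>i. i \<in> V \<Longrightarrow> hyperbolic V (T i)"
    and conn: "\<And>(f :: 'i \<Rightarrow> real) i j i' j'. (\<And>i j. i \<in> V \<Longrightarrow> j \<in> V \<Longrightarrow> H i j > 0 \<Longrightarrow> f i = f j) \<Longrightarrow>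
      i \<in> V \<Longrightarrow> j \<in> V \<Longrightarrow> H i i' > 0 \<Longrightarrow> H j j' > 0 \<Longrightarrow> i' \<in> V \<Longrightarrow> j' \<in> V \<Longrightarrow> f i = f j"
  shows "hyperbolic V H"
proof (rule hyperbolicI_perp[OF symH, where W=W], rule ccontr)
  fix x
  assume x0: "bilin V H x W = 0" and "\<not> bilin V H x x \<le> 0"
  then have x1: "bilin V H x x > 0" by simp
  have Hnn: "H i j \<ge> 0" if "i \<in> V" "j \<in> V" for i j
  proof -
    have "0 \<le> c * H i j"
      unfolding euler[OF that, symmetric]
      by (intro sum_nonneg mult_nonneg_nonneg nonneg) (use W in \<open>auto simp: less_imp_le\<close>)
    then show ?thesis using c by (simp add: zero_le_mult_iff)
  qed
  define r where "r i = (\<Sum>j\<in>V. H i j * W j)" for i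
  define A where "A = {i\<in>V. r i > 0}"
  define d where "d i = r i / W i" for i
  have A: "A \<subseteq> V" "finite A" using fin by (auto simp: A_def)
  have rnn: "r i \<ge> 0" if "i \<in> V" for i
    unfolding r_def by (intro sum_nonneg mult_nonneg_nonneg Hnn that) (use W in \<open>auto simp: less_imp_le\<close>)
  have zero: "H i j = 0" if "i \<in> V" "j \<in> V" "i \<notin> A \<or> j \<notin> A" for i j
  proof -
    have *: "H i j = 0" if "i \<in> V" "j \<in> V" "i \<notin> A" for i j
    proof -
      have "r i = 0" using rnn[of i] that by (auto simp: A_def)
      then have "\<forall>j\<in>V. H i j * W j = 0"
        unfolding r_def by (subst (asm) sum_nonneg_eq_0_iff)
          (use fin Hnn W that in \<open>auto intro!: mult_nonneg_nonneg simp: less_imp_le\<close>)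
      then show ?thesis using that W[of j] by force
    qed
    show ?thesis using *[of i j] *[of j i] symH[of i j] that by auto
  qed
  have bilA: "bilin V H u v = bilin A H u v" for u v
  proof -
    have "bilin V H u v = (\<Sum>i\<in>V. u i * (\<Sum>j\<in>A. H i j * v j))"
      unfolding bilin_def using A fin zero
      by (intro sum.cong refl arg_cong2[where f="(*)"] sum.mono_neutral_right) auto
    also have "\<dots> = bilin A H u v"
      unfolding bilin_def
    proof (rule sum.mono_neutral_right)
      show "\<forall>i\<in>V - A. u i * (\<Sum>j\<in>A. H i j * v j) = 0"
        using zero A by (auto intro!: sum.neutral)
    qed (use A fin in auto)
    finally show ?thesis .
  qed
  have dpos: "d i > 0" if "i \<in> A" for i
    using that W[of i] by (auto simp: A_def d_def)
  have Wr: "W i * d i = r i" if "i \<in> A" for i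
    using that W[of i] A by (force simp: d_def)
  have rA: "r i = (\<Sum>j\<in>A. H i j * W j)" if "i \<in> V" for i
    unfolding r_def using A fin zero that by (intro sum.mono_neutral_right) auto
  have perp: "bilin A H u W = (\<Sum>i\<in>A. r i * u i)" for u
    unfolding bilin_def using A by (intro sum.cong) (auto simp: rA mult.commute)
  have x2: "(\<Sum>i\<in>A. r i * x i) = 0" "bilin A H x x > 0"
    using x0 x1 perp bilA by auto
  obtain v l where v: "(\<Sum>i\<in>A. r i * v i) = 0" "(\<Sum>i\<in>A. d i * (v i)\<^sup>2) = 1" "l > 0" "bilin A H v v = l"
    and max: "\<And>u. (\<Sum>i\<in>A. r i * u i) = 0 \<Longrightarrow> bilin A H u u \<le> l * (\<Sum>i\<in>A. d i * (u i)\<^sup>2)"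
    using rayleigh_maximizer[where d=d, OF A(2) dpos x2] by blast
  have Apos: "(\<Sum>i\<in>A. r i * W i) > 0"
  proof -
    have "A \<noteq> {}" using v(2) by auto
    then show ?thesis using A W by (intro sum_pos) (auto simp: A_def)
  qed

  \<comment> \<open>First-order condition at the maximiser: \<open>v + e * u\<close> stays in the
    hyperplane, so a quadratic in \<open>e\<close> without constant term is nonnegative.\<close>
  have stat: "bilin A H v u = l * (\<Sum>i\<in>A. d i * v i * u i)" if u: "(\<Sum>i\<in>A. r i * u i) = 0" for u
  proof -
    have "l * (\<Sum>i\<in>A. d i * v i * u i) - bilin A H v u = 0"
    proof (rule linear_coeff_zero[where s = "l * (\<Sum>i\<in>A. d i * (u i)\<^sup>2) - bilin A H u u"])
      fix e :: real
      let ?w = "\<lambda>i. 1 * v i + e * u i"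
      have "(\<Sum>i\<in>A. r i * ?w i) = (\<Sum>i\<in>A. r i * v i) + e * (\<Sum>i\<in>A. r i * u i)"
        by (simp add: sum.distrib sum_distrib_left algebra_simps)
      then have "bilin A H ?w ?w \<le> l * (\<Sum>i\<in>A. d i * (?w i)\<^sup>2)"
        using u v(1) by (intro max) simp
      also have "(\<Sum>i\<in>A. d i * (?w i)\<^sup>2) =
          (\<Sum>i\<in>A. d i * (v i)\<^sup>2) + 2 * e * (\<Sum>i\<in>A. d i * v i * u i) + e\<^sup>2 * (\<Sum>i\<in>A. d i * (u i)\<^sup>2)"
        by (simp add: sum.distrib sum_distrib_left power2_eq_square algebra_simps)
      finally show "0 \<le> 2 * e * (l * (\<Sum>i\<in>A. d i * v i * u i) - bilin A H v u)
          + e\<^sup>2 * (l * (\<Sum>i\<in>A. d i * (u i)\<^sup>2) - bilin A H u u)"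
        unfolding bilin_quad[OF symH] using v by (simp add: algebra_simps)
    qed
    then show ?thesis by simp
  qed
  define s where "s i = (\<Sum>j\<in>A. H i j * v j)" for i
  have vW: "bilin A H v W = 0" unfolding perp using v(1) by simp
  have vW': "(\<Sum>i\<in>A. d i * v i * W i) = 0"
    using v(1) by (simp add: Wr mult.commute mult.left_commute mult.assoc[symmetric] cong: sum.cong)
  have eig: "s i = l * d i * v i" if i: "i \<in> A" for i
  proof -
    \<comment> \<open>Subtracting \<open>b * W\<close> moves the unit vector at \<open>i\<close>
      into the hyperplane. Both sides of the first-order condition vanish at \<open>W\<close>, so
      the correction drops out and an eigenvalue equation at \<open>i\<close> remains.\<close>
    define b where "b = r i / (\<Sum>i\<in>A. r i * W i)"
    define e where "e j = (if j = i then 1 else 0 :: real)" for j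
    let ?u = "\<lambda>j. 1 * e j + (- b) * W j"
    have "(\<Sum>j\<in>A. r j * ?u j) = (\<Sum>j\<in>A. r j * e j) - b * (\<Sum>j\<in>A. r j * W j)"
      by (simp add: sum_subtractf sum_distrib_left algebra_simps)
    also have "\<dots> = 0"
      using Apos i A by (simp add: b_def e_def if_distrib[of "(*) _"] cong: if_cong)
    finally have st: "bilin A H v ?u = l * (\<Sum>j\<in>A. d j * v j * ?u j)" by (rule stat)
    have "bilin A H v ?u = bilin A H v e"
      unfolding bilin_right using vW by simp
    also have "\<dots> = bilin A H e v" by (rule bilin_commute[OF symH])
    also have "\<dots> = (\<Sum>j\<in>A. if j = i then s j else 0)"
      unfolding bilin_def s_def by (rule sum.cong) (auto simp: e_def)
    also have "\<dots> = s i" using i A by simp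
    finally have 1: "bilin A H v ?u = s i" .
    have "(\<Sum>j\<in>A. d j * v j * ?u j) = (\<Sum>j\<in>A. d j * v j * e j) - b * (\<Sum>j\<in>A. d j * v j * W j)"
      by (simp add: sum_subtractf sum_distrib_left algebra_simps)
    also have "\<dots> = (\<Sum>j\<in>A. if j = i then d j * v j else 0)"
      unfolding vW' e_def by (simp add: if_distrib cong: if_cong)
    also have "\<dots> = d i * v i" using i A by simp
    finally show ?thesis using 1 st by simp
  qed

  have Tz: "T i j k = 0" if i: "i \<in> V" "i \<notin> A" "j \<in> V" "k \<in> V" for i j k
  proof -
    have "(\<Sum>k\<in>V. T i j k * W k) = 0" using euler[of i j] zero[of i j] i by simp
    then have "\<forall>k\<in>V. T i j k * W k = 0"
      by (subst (asm) sum_nonneg_eq_0_iff)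
        (use fin nonneg W in \<open>auto intro!: mult_nonneg_nonneg simp: less_imp_le\<close>)
    then show ?thesis using that W[of k] by force
  qed
  have TW: "bilin V (T i) u W = c * (\<Sum>j\<in>V. H i j * u j)" if "i \<in> V" for i u
    by (rule bilin_euler) (use euler that in auto)
  have sV: "(\<Sum>j\<in>V. H i j * v j) = s i" if "i \<in> V" for i
    unfolding s_def using A fin zero that by (intro sum.mono_neutral_right) auto
  \<comment> \<open>Hyperbolicity of \<open>T i\<close> is tested on \<open>W\<close> and
    \<open>v\<close>. Pairing \<open>T i\<close> with \<open>W\<close> gives \<open>c\<close> times
    row \<open>i\<close> of \<open>H\<close>, so both comparison values are known.\<close>
  have bochner: "W i * bilin V (T i) v v \<le> c * (W i * (s i)\<^sup>2 / r i)" if i: "i \<in> A" for i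
  proof -
    have iV: "i \<in> V" and ri: "r i > 0" using i by (auto simp: A_def)
    have "bilin V (T i) W W = c * r i" unfolding TW[OF iV] r_def ..
    moreover have "bilin V (T i) W v = c * s i"
      using TW[OF iV, of v] sV[OF iV] bilin_commute[where H="T i" and u=v and v=W] symT(1) by metis
    ultimately have "(c * r i) * bilin V (T i) v v \<le> (c * s i)\<^sup>2"
      using hyp[OF iV] c ri unfolding hyperbolic_def by (metis mult_pos_pos)
    then have "c * (r i * bilin V (T i) v v) \<le> c * (c * (s i)\<^sup>2)"
      by (simp add: power2_eq_square mult_ac)
    then have "r i * bilin V (T i) v v \<le> c * (s i)\<^sup>2" using c by simp
    then have "bilin V (T i) v v \<le> c * (s i)\<^sup>2 / r i" using ri by (simp add: field_simps)
    then have "W i * bilin V (T i) v v \<le> W i * (c * (s i)\<^sup>2 / r i)"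
      using W[OF iV] by (intro mult_left_mono) auto
    then show ?thesis by (simp add: mult_ac)
  qed
  have "c * l = (\<Sum>i\<in>V. W i * bilin V (T i) v v)"
  proof -
    have "(\<Sum>i\<in>V. W i * bilin V (T i) v v) = c * bilin V H v v"
      by (rule bilin_euler_sum) (use symT euler in auto)
    then show ?thesis using bilA v(4) by simp
  qed
  also have "\<dots> = (\<Sum>i\<in>A. W i * bilin V (T i) v v)"
  proof (rule sum.mono_neutral_right)
    show "\<forall>i\<in>V - A. W i * bilin V (T i) v v = 0"
      by (auto simp: bilin_def Tz)
  qed (use A fin in auto)
  also have "\<dots> \<le> (\<Sum>i\<in>A. c * (W i * (s i)\<^sup>2 / r i))"
    by (intro sum_mono bochner)
  also have "\<dots> = (\<Sum>i\<in>A. c * l\<^sup>2 * (d i * (v i)\<^sup>2))"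
  proof (rule sum.cong)
    fix i assume i: "i \<in> A"
    then have "W i > 0" "r i > 0" using W A by (auto simp: A_def)
    then show "c * (W i * (s i)\<^sup>2 / r i) = c * l\<^sup>2 * (d i * (v i)\<^sup>2)"
      unfolding eig[OF i] d_def by (simp add: power2_eq_square field_simps)
  qed simp
  also have "\<dots> = c * l\<^sup>2"
    unfolding sum_distrib_left[symmetric] v(2) by simp
  finally have l1: "1 \<le> l" using c v(3) by (simp add: power2_eq_square)

  \<comment> \<open>After expanding, each of the two pure squares sums to the \<open>d\<close>-norm
    of \<open>v\<close>, which is one, and the mixed term to \<open>l\<close>. With
    \<open>l >= 1\<close> a sum of nonnegative terms is nonpositive, hence \<open>v / W\<close> is
    constant along positive entries.\<close>
  have dirichlet: "(\<Sum>i\<in>A. \<Sum>j\<in>A. H i j * W i * W j * (v i / W i - v j / W j)\<^sup>2) = 2 - 2 * l"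
  proof -
    have "(\<Sum>i\<in>A. \<Sum>j\<in>A. H i j * W i * W j * (v i / W i - v j / W j)\<^sup>2)
       = (\<Sum>i\<in>A. \<Sum>j\<in>A. (v i)\<^sup>2 / W i * (H i j * W j) + (v j)\<^sup>2 / W j * (H j i * W i) - 2 * (v i * (H i j * v j)))"
    proof (intro sum.cong refl)
      fix i j assume "i \<in> A" "j \<in> A"
      then have "W i > 0" "W j > 0" using W A by auto
      then show "H i j * W i * W j * (v i / W i - v j / W j)\<^sup>2 =
        (v i)\<^sup>2 / W i * (H i j * W j) + (v j)\<^sup>2 / W j * (H j i * W i) - 2 * (v i * (H i j * v j))"
        using symH[of j i] by (simp add: power2_diff power_divide) (simp add: power2_eq_square divide_simps, simp add: algebra_simps)
    qed
    also have "\<dots> = (\<Sum>i\<in>A. \<Sum>j\<in>A. (v i)\<^sup>2 / W i * (H i j * W j))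
       + (\<Sum>i\<in>A. \<Sum>j\<in>A. (v j)\<^sup>2 / W j * (H j i * W i)) - 2 * bilin A H v v"
      by (simp add: sum.distrib sum_subtractf bilin_def sum_distrib_left)
    also have "(\<Sum>i\<in>A. \<Sum>j\<in>A. (v j)\<^sup>2 / W j * (H j i * W i)) = (\<Sum>i\<in>A. \<Sum>j\<in>A. (v i)\<^sup>2 / W i * (H i j * W j))"
      by (rule sum.swap)
    also have "(\<Sum>i\<in>A. \<Sum>j\<in>A. (v i)\<^sup>2 / W i * (H i j * W j)) = (\<Sum>i\<in>A. d i * (v i)\<^sup>2)"
      unfolding sum_distrib_left[symmetric] using A
      by (intro sum.cong) (auto simp: rA[symmetric] d_def)
    finally show ?thesis using v by simp
  qed
  have summand_nonneg: "H i j * W i * W j * (v i / W i - v j / W j)\<^sup>2 \<ge> 0" if "i \<in> A" "j \<in> A" for i j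
    using Hnn[of i j] W[of i] W[of j] that A by (intro mult_nonneg_nonneg) (auto simp: less_imp_le)
  have "(\<Sum>i\<in>A. \<Sum>j\<in>A. H i j * W i * W j * (v i / W i - v j / W j)\<^sup>2) \<ge> 0"
    by (intro sum_nonneg summand_nonneg)
  with dirichlet l1 have "(\<Sum>i\<in>A. \<Sum>j\<in>A. H i j * W i * W j * (v i / W i - v j / W j)\<^sup>2) = 0" by simp
  then have "\<forall>i\<in>A. (\<Sum>j\<in>A. H i j * W i * W j * (v i / W i - v j / W j)\<^sup>2) = 0"
    by (subst (asm) sum_nonneg_eq_0_iff[OF A(2)]) (auto intro!: sum_nonneg summand_nonneg)
  then have "\<forall>i\<in>A. \<forall>j\<in>A. H i j * W i * W j * (v i / W i - v j / W j)\<^sup>2 = 0"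
  proof (intro ballI)
    fix i j assume ij: "i \<in> A" "j \<in> A"
    from \<open>\<forall>i\<in>A. (\<Sum>j\<in>A. H i j * W i * W j * (v i / W i - v j / W j)\<^sup>2) = 0\<close> ij(1)
    have "(\<Sum>j\<in>A. H i j * W i * W j * (v i / W i - v j / W j)\<^sup>2) = 0" by blast
    then show "H i j * W i * W j * (v i / W i - v j / W j)\<^sup>2 = 0"
      by (subst (asm) sum_nonneg_eq_0_iff[OF A(2)]) (use ij summand_nonneg in auto)
  qed
  then have eqA: "v i / W i = v j / W j" if "i \<in> A" "j \<in> A" "H i j > 0" for i j
    using that W[of i] W[of j] A by force
  have const: "v i / W i = v j / W j" if ij: "i \<in> A" "j \<in> A" for i j
  proof -
    have ex: "\<exists>k\<in>V. H i k > 0" if "i \<in> A" for i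
    proof (rule ccontr)
      assume "\<not> ?thesis"
      then have "r i \<le> 0" using W unfolding r_def
        by (intro sum_nonpos) (auto simp: mult_le_0_iff not_less less_imp_le)
      then show False using that by (simp add: A_def)
    qed
    obtain i' j' where "i' \<in> V" "j' \<in> V" "H i i' > 0" "H j j' > 0" using ex ij by blast
    moreover have "v i / W i = v j / W j" if "i \<in> V" "j \<in> V" "H i j > 0" for i j
      using eqA[of i j] zero[of i j] that by force
    ultimately show ?thesis
      using conn[of "\<lambda>i. v i / W i" i j i' j'] ij A by blast
  qed
  obtain a where a: "a \<in> A" using v(2) by fastforce
  define q where "q = v a / W a"
  have vq: "v i = q * W i" if "i \<in> A" for i
    using const[OF that a] W[of i] that A unfolding q_def by (force simp: field_simps)
  have "(\<Sum>i\<in>A. r i * v i) = q * (\<Sum>i\<in>A. r i * W i)"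
    unfolding sum_distrib_left by (intro sum.cong) (auto simp: vq)
  then have "q = 0" using v(1) Apos by simp
  then have "(\<Sum>i\<in>A. d i * (v i)\<^sup>2) = 0" by (simp add: vq)
  then show False using v(2) by simp
qed

text \<open>On the orthogonal complement of \<open>p\<close> the form is negative semidefinite. A
  null vector of a semidefinite form is orthogonal to the whole complement, and \<open>u\<close> is
  orthogonal to \<open>p\<close> as well.\<close>

lemma hyperbolic_null_kernel:
  assumes fin: "finite V" and sym: "\<And>i j. H i j = H j i" and hyp: "hyperbolic V H"
    and p: "bilin V H p p > 0" "bilin V H p u = 0" and u: "bilin V H u u = 0" and i: "i \<in> V"
  shows "(\<Sum>j\<in>V. H i j * u j) = 0"
proof -
  have 0: "bilin V H u v = 0" for v
  proof -
    define b where "b = bilin V H p v / bilin V H p p"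
    let ?w = "\<lambda>i. 1 * v i + (- b) * p i"
    have pw: "bilin V H p ?w = 0" unfolding bilin_right b_def using p by simp
    have uw: "bilin V H u ?w = bilin V H u v"
      unfolding bilin_right using p(2) bilin_commute[where H=H and u=u and v=p, OF sym] by simp
    have "- bilin V H u ?w = 0"
    proof (rule linear_coeff_zero[where s = "- bilin V H ?w ?w"])
      fix e :: real
      let ?y = "\<lambda>i. 1 * u i + e * ?w i"
      have "bilin V H p ?y = 1 * bilin V H p u + e * bilin V H p ?w" by (rule bilin_right)
      then have "bilin V H p ?y = 0" using p(2) pw by simp
      moreover have "bilin V H p p * bilin V H ?y ?y \<le> (bilin V H p ?y)\<^sup>2"
        using hyp p(1) unfolding hyperbolic_def by blast
      ultimately have "bilin V H ?y ?y \<le> 0" using p(1) by (simp add: mult_le_0_iff)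
      also have "bilin V H ?y ?y = 1\<^sup>2 * bilin V H u u + 2 * 1 * e * bilin V H u ?w + e\<^sup>2 * bilin V H ?w ?w"
        by (rule bilin_quad[OF sym])
      finally show "0 \<le> 2 * e * - bilin V H u ?w + e\<^sup>2 * - bilin V H ?w ?w"
        using u by simp
    qed
    then show ?thesis using uw by simp
  qed
  define e where "e j = (if j = i then 1 else 0 :: real)" for j
  have "bilin V H e u = (\<Sum>j\<in>V. if j = i then (\<Sum>k\<in>V. H j k * u k) else 0)"
    unfolding bilin_def by (rule sum.cong) (auto simp: e_def)
  also have "\<dots> = (\<Sum>j\<in>V. H i j * u j)" using i fin by simp
  finally show ?thesis using 0[of e] bilin_commute[where H=H and u=u and v=e, OF sym] by simp
qed

text \<open>Pairing \<open>T k\<close> with \<open>W\<close> and \<open>u\<close> gives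
  \<open>c\<close> times row \<open>k\<close> of \<open>H\<close> at \<open>u\<close>, which is
  zero. So each \<open>T k\<close> of positive weight is nonpositive at \<open>u\<close>, while the
  weighted sum of these values is \<open>c\<close> times the value of \<open>H\<close> at
  \<open>u\<close>, again zero. All these terms therefore vanish, and \<open>u\<close> is a null
  vector orthogonal to \<open>W\<close>. The weights are only nonnegative because z has weight zero
  at \<open>t = 0\<close>; \<open>other\<close> covers the forms that are not positive at
  \<open>W\<close>.\<close>

lemma hyperbolic_kernel_descent:
  assumes fin: "finite V"
    and symT: "\<And>i j l. T i j l = T i l j" "\<And>i j l. T i j l = T j i l"
    and W: "\<And>i. i \<in> V \<Longrightarrow> W i \<ge> 0"
    and euler: "\<And>i j. i \<in> V \<Longrightarrow> j \<in> V \<Longrightarrow> (\<Sum>l\<in>V. T i j l * W l) = c * H i j"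
    and hyp: "\<And>i. i \<in> V \<Longrightarrow> hyperbolic V (T i)"
    and ker: "\<And>i. i \<in> V \<Longrightarrow> (\<Sum>j\<in>V. H i j * u j) = 0"
    and other: "\<And>i. i \<in> V \<Longrightarrow> W i > 0 \<Longrightarrow> bilin V (T i) W W \<le> 0 \<Longrightarrow> bilin V (T i) u u \<le> 0"
    and i: "i \<in> V" "W i > 0" "bilin V (T i) W W > 0" and j: "j \<in> V"
  shows "(\<Sum>l\<in>V. T i j l * u l) = 0"
proof -
  have TW: "bilin V (T i) u W = c * (\<Sum>j\<in>V. H i j * u j)" if "i \<in> V" for i u
    by (rule bilin_euler) (use euler that in auto)
  have perp: "bilin V (T k) W u = 0" if "k \<in> V" for k
    using TW[OF that, of u] ker[OF that] bilin_commute[where H="T k" and u=u and v=W] symT(1)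
    by (metis mult_zero_right)
  have le: "bilin V (T k) u u \<le> 0" if "k \<in> V" "W k > 0" for k
  proof (cases "bilin V (T k) W W > 0")
    case True
    then have "bilin V (T k) W W * bilin V (T k) u u \<le> (bilin V (T k) W u)\<^sup>2"
      using hyp[OF that(1)] unfolding hyperbolic_def by blast
    then show ?thesis using True perp[OF that(1)] by (simp add: mult_le_0_iff)
  qed (use other that in auto)
  have le': "W k * bilin V (T k) u u \<le> 0" if "k \<in> V" for k
    using le[OF that] W[OF that] by (cases "W k > 0") (auto simp: mult_le_0_iff)
  have "bilin V H u u = 0" using ker by (simp add: bilin_def)
  moreover have "(\<Sum>k\<in>V. W k * bilin V (T k) u u) = c * bilin V H u u"
    by (rule bilin_euler_sum) (use symT euler in auto)
  ultimately have "(\<Sum>k\<in>V. W k * bilin V (T k) u u) = 0" by simp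
  then have "(\<Sum>k\<in>V. - (W k * bilin V (T k) u u)) = 0" by (simp add: sum_negf)
  then have "\<forall>k\<in>V. - (W k * bilin V (T k) u u) = 0"
    by (subst (asm) sum_nonneg_eq_0_iff) (use fin le' in auto)
  then have "bilin V (T i) u u = 0" using i by auto
  then show ?thesis
    using hyperbolic_null_kernel[OF fin symT(1) hyp[OF i(1)] i(3) perp[OF i(1)] _ j] by blast
qed

section \<open>Exchange families and their polynomials\<close>

definition link :: "'a set set \<Rightarrow> 'a \<Rightarrow> 'a set set" where
  "link B x = {S. x \<notin> S \<and> insert x S \<in> B}"

text \<open>A set-system form of M-natural-convexity: padding all sets to a common size with copies of a
  dummy element turns both conditions into the basis exchange property.\<close>

definition exchange_family :: "'a set set \<Rightarrow> bool" where
  "exchange_family B \<longleftrightarrow> finite (\<Union>B) \<and>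
     (\<forall>S\<in>B. \<forall>T\<in>B. card S < card T \<longrightarrow> (\<exists>y\<in>T - S. insert y S \<in> B)) \<and>
     (\<forall>S\<in>B. \<forall>T\<in>B. \<forall>x\<in>S - T.
        card T < card S \<and> S - {x} \<in> B \<or> (\<exists>y\<in>T - S. insert y (S - {x}) \<in> B))"

lemma exchange_family_finite: "exchange_family B \<Longrightarrow> S \<in> B \<Longrightarrow> finite S"
  unfolding exchange_family_def by (meson Union_upper finite_subset)

lemma exchange_family_finite_family: "exchange_family B \<Longrightarrow> finite B"
  unfolding exchange_family_def by (meson finite_UnionD)

lemma exchange_family_augment:
  assumes "exchange_family B" "S \<in> B" "T \<in> B" "card S < card T"
  obtains y where "y \<in> T" "y \<notin> S" "insert y S \<in> B"
  using assms unfolding exchange_family_def by blast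

lemma exchange_family_exchange:
  assumes "exchange_family B" "S \<in> B" "T \<in> B" "x \<in> S" "x \<notin> T"
  obtains "card T < card S" "S - {x} \<in> B" | y where "y \<in> T" "y \<notin> S" "insert y (S - {x}) \<in> B"
  using assms unfolding exchange_family_def by blast

lemma Union_link: "\<Union>(link B x) \<subseteq> \<Union>B - {x}"
  by (auto simp: link_def)

lemma exchange_family_link:
  assumes B: "exchange_family B"
  shows "exchange_family (link B x)"
  unfolding exchange_family_def
proof (intro conjI ballI impI)
  show "finite (\<Union>(link B x))"
    using B finite_subset[OF Union_link[of B x]] by (auto simp: exchange_family_def)
next
  fix S T assume S: "S \<in> link B x" and T: "T \<in> link B x" and "card S < card T"
  moreover have "finite S" "finite T" "x \<notin> S" "x \<notin> T"
    using S T exchange_family_finite[OF B, of "insert x S"] exchange_family_finite[OF B, of "insert x T"]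
    by (auto simp: link_def)
  ultimately have "card (insert x S) < card (insert x T)" by simp
  then obtain y where "y \<in> insert x T" "y \<notin> insert x S" "insert y (insert x S) \<in> B"
    using S T exchange_family_augment[OF B, of "insert x S" "insert x T"] by (auto simp: link_def)
  then show "\<exists>y\<in>T - S. insert y S \<in> link B x"
    using S T by (auto simp: link_def insert_commute)
next
  fix S T u assume S: "S \<in> link B x" and T: "T \<in> link B x" and u: "u \<in> S - T"
  have ux: "u \<noteq> x" using S u by (auto simp: link_def)
  have card: "card (insert x T) < card (insert x S) \<longleftrightarrow> card T < card S"
    using S T exchange_family_finite[OF B, of "insert x S"] exchange_family_finite[OF B, of "insert x T"]
    by (auto simp: link_def)
  have "insert x S \<in> B" "insert x T \<in> B" "u \<in> insert x S" "u \<notin> insert x T"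
    using S T u ux by (auto simp: link_def)
  from exchange_family_exchange[OF B this]
  show "card T < card S \<and> S - {u} \<in> link B x \<or> (\<exists>y\<in>T - S. insert y (S - {u}) \<in> link B x)"
  proof cases
    case 1
    moreover have "insert x S - {u} = insert x (S - {u})" using ux by auto
    ultimately show ?thesis using S card by (auto simp: link_def)
  next
    case (2 y)
    moreover have "insert y (insert x S - {u}) = insert x (insert y (S - {u}))" using ux by auto
    ultimately show ?thesis using S by (auto simp: link_def)
  qed
qed

text \<open>The sum of \<open>w\<^sup>S t\<^bsup>e + d - |S|\<^esup>\<close> over the family, differentiated \<open>e\<close> times in \<open>t\<close> and divided
  by \<open>e!\<close>, which makes it homogeneous of degree \<open>d\<close>. A derivative along \<open>x\<close> keeps \<open>e\<close>, a derivative
  along \<open>t\<close> raises it. The index \<open>None\<close> stands for the variable \<open>t\<close>.\<close>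

definition hpoly :: "('a \<Rightarrow> real) \<Rightarrow> real \<Rightarrow> 'a set set \<Rightarrow> nat \<Rightarrow> nat \<Rightarrow> real" where
  "hpoly w t B e d = (\<Sum>S\<in>B. (\<Prod>x\<in>S. w x) *
     (if card S \<le> d then t ^ (d - card S) * real ((e + (d - card S)) choose e) else 0))"

definition der_fam :: "'a option \<Rightarrow> 'a set set \<Rightarrow> 'a set set" where
  "der_fam i B = (case i of None \<Rightarrow> B | Some x \<Rightarrow> link B x)"

definition der_lev :: "'a option \<Rightarrow> nat \<Rightarrow> nat" where
  "der_lev i e = (case i of None \<Rightarrow> Suc e | Some x \<Rightarrow> e)"

text \<open>The factor \<open>e + 1\<close> comes from the normalisation: differentiating an
  \<open>e\<close>-th derivative divided by the factorial of \<open>e\<close> gives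
  \<open>e + 1\<close> times the next normalised derivative.\<close>

definition der_coeff :: "'a option \<Rightarrow> nat \<Rightarrow> real" where
  "der_coeff i e = (case i of None \<Rightarrow> real (Suc e) | Some x \<Rightarrow> 1)"

lemmas der_defs = der_fam_def der_lev_def der_coeff_def

text \<open>Here \<open>d\<close> is the degree of the polynomial minus two; in \<open>third_deriv\<close> it is the degree minus three.\<close>

definition hessian :: "('a \<Rightarrow> real) \<Rightarrow> real \<Rightarrow> 'a set set \<Rightarrow> nat \<Rightarrow> nat \<Rightarrow> 'a option \<Rightarrow> 'a option \<Rightarrow> real" where
  "hessian w t B e d i j = der_coeff i e * der_coeff j (der_lev i e) *
     hpoly w t (der_fam j (der_fam i B)) (der_lev j (der_lev i e)) d"

definition third_deriv :: "('a \<Rightarrow> real) \<Rightarrow> real \<Rightarrow> 'a set set \<Rightarrow> nat \<Rightarrow> nat \<Rightarrow> 'a option \<Rightarrow> 'a option \<Rightarrow> 'a option \<Rightarrow> real" where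
  "third_deriv w t B e d l i j = der_coeff l e * hessian w t (der_fam l B) (der_lev l e) d i j"

definition idx :: "'a set \<Rightarrow> 'a option set" where
  "idx X = insert None (Some ` X)"

definition wt :: "('a \<Rightarrow> real) \<Rightarrow> real \<Rightarrow> 'a option \<Rightarrow> real" where
  "wt w t i = (case i of None \<Rightarrow> t | Some x \<Rightarrow> w x)"

section \<open>Symmetry of the derivatives, Euler's relation and positivity\<close>

lemma finite_idx: "finite X \<Longrightarrow> finite (idx X)"
  by (simp add: idx_def)

lemma sum_idx: "finite X \<Longrightarrow> sum f (idx X) = f None + (\<Sum>x\<in>X. f (Some x))"
  unfolding idx_def by (subst sum.insert) (auto simp: sum.reindex)

lemma link_commute: "link (link B x) y = link (link B y) x"
  by (auto simp: link_def insert_commute)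

lemma der_fam_commute: "der_fam i (der_fam j B) = der_fam j (der_fam i B)"
  by (auto simp: der_defs link_commute split: option.splits)

lemma der_lev_commute: "der_lev i (der_lev j e) = der_lev j (der_lev i e)"
  by (auto simp: der_defs split: option.splits)

lemma der_coeff_commute: "der_coeff i e * der_coeff j (der_lev i e) = der_coeff j e * der_coeff i (der_lev j e)"
  by (auto simp: der_defs split: option.splits)

lemma hessian_sym: "hessian w t B e d i j = hessian w t B e d j i"
  unfolding hessian_def
  by (simp add: der_coeff_commute[of i e j] der_fam_commute[of i j] der_lev_commute[of i j])

lemma third_deriv_sym: "third_deriv w t B e d i j l = third_deriv w t B e d i l j" "third_deriv w t B e d i j l = third_deriv w t B e d j i l"
proof -
  show "third_deriv w t B e d i j l = third_deriv w t B e d i l j"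
    unfolding third_deriv_def by (simp add: hessian_sym[of _ _ _ _ _ j l])
  have "third_deriv w t B e d i j l = (der_coeff i e * der_coeff j (der_lev i e)) * (der_coeff l (der_lev j (der_lev i e)) *
     hpoly w t (der_fam l (der_fam j (der_fam i B))) (der_lev l (der_lev j (der_lev i e))) d)"
    unfolding third_deriv_def hessian_def by (simp add: mult_ac)
  also have "\<dots> = third_deriv w t B e d j i l"
    unfolding third_deriv_def hessian_def
    by (simp add: der_coeff_commute[of i e j] der_fam_commute[of i j] der_lev_commute[of i j])
  finally show "third_deriv w t B e d i j l = third_deriv w t B e d j i l" .
qed

text \<open>Removing \<open>x\<close> lowers the size of the set and the degree together, so the
  exponent of \<open>t\<close> and the binomial coefficient do not change.\<close>

lemma hpoly_link:
  assumes B: "finite B" "\<And>S. S \<in> B \<Longrightarrow> finite S"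
  shows "w x * hpoly w t (link B x) e d = (\<Sum>S\<in>B. if x \<in> S then (\<Prod>x\<in>S. w x) *
     (if card S \<le> Suc d then t ^ (Suc d - card S) * real ((e + (Suc d - card S)) choose e) else 0) else 0)"
proof -
  have "w x * hpoly w t (link B x) e d = (\<Sum>S\<in>{S\<in>B. x \<in> S}. (\<Prod>x\<in>S. w x) *
     (if card S \<le> Suc d then t ^ (Suc d - card S) * real ((e + (Suc d - card S)) choose e) else 0))"
    unfolding hpoly_def sum_distrib_left
  proof (rule sum.reindex_bij_witness[where i = "\<lambda>S. S - {x}" and j = "insert x"])
    fix S assume S: "S \<in> link B x"
    then have "finite S" "x \<notin> S" using B(2)[of "insert x S"] by (auto simp: link_def)
    then show "(\<Prod>x\<in>insert x S. w x) * (if card (insert x S) \<le> Suc d then t ^ (Suc d - card (insert x S)) *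
        real ((e + (Suc d - card (insert x S))) choose e) else 0)
      = w x * ((\<Prod>x\<in>S. w x) * (if card S \<le> d then t ^ (d - card S) * real ((e + (d - card S)) choose e) else 0))"
      by simp
  qed (auto simp: link_def insert_absorb)
  also have "\<dots> = (\<Sum>S\<in>B. if x \<in> S then (\<Prod>x\<in>S. w x) *
     (if card S \<le> Suc d then t ^ (Suc d - card S) * real ((e + (Suc d - card S)) choose e) else 0) else 0)"
    using B(1) by (rule sum.inter_filter)
  finally show ?thesis .
qed

text \<open>A set \<open>S\<close> is counted \<open>card S\<close> times by its elements and
  \<open>Suc d - card S\<close> times by the exponent of \<open>t\<close>, together
  \<open>Suc d\<close> times.\<close>

lemma hpoly_euler:
  assumes X: "finite X" "\<Union>B \<subseteq> X"
  shows "(\<Sum>i\<in>idx X. der_coeff i e * hpoly w t (der_fam i B) (der_lev i e) d * wt w t i)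
           = real (Suc d) * hpoly w t B e (Suc d)"
proof -
  have fB: "finite B" using X by (meson finite_UnionD finite_subset)
  have fS: "finite S" "S \<subseteq> X" if "S \<in> B" for S using X that by (auto intro: finite_subset)
  define g where "g S = (\<Prod>x\<in>S. w x) *
     (if card S \<le> Suc d then t ^ (Suc d - card S) * real ((e + (Suc d - card S)) choose e) else 0)" for S
  have "(\<Sum>x\<in>X. w x * hpoly w t (link B x) e d) = (\<Sum>x\<in>X. \<Sum>S\<in>B. if x \<in> S then g S else 0)"
    unfolding g_def by (intro sum.cong refl hpoly_link fB fS)
  also have "\<dots> = (\<Sum>S\<in>B. \<Sum>x\<in>X. if x \<in> S then g S else 0)" by (rule sum.swap)
  also have "\<dots> = (\<Sum>S\<in>B. real (card S) * g S)"
  proof (rule sum.cong[OF refl])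
    fix S assume "S \<in> B"
    then have "{x\<in>X. x \<in> S} = S" using fS by auto
    then show "(\<Sum>x\<in>X. if x \<in> S then g S else 0) = real (card S) * g S"
      using X by (simp add: sum.inter_filter[symmetric])
  qed
  finally have 1: "(\<Sum>x\<in>X. w x * hpoly w t (link B x) e d) = (\<Sum>S\<in>B. real (card S) * g S)" .
  have 2: "real (Suc e) * hpoly w t B (Suc e) d * t = (\<Sum>S\<in>B. (real (Suc d) - real (card S)) * g S)"
    unfolding hpoly_def sum_distrib_left sum_distrib_right
  proof (rule sum.cong[OF refl])
    fix S assume "S \<in> B"
    show "real (Suc e) * ((\<Prod>x\<in>S. w x) * (if card S \<le> d then t ^ (d - card S) *
        real ((Suc e + (d - card S)) choose (Suc e)) else 0)) * t = (real (Suc d) - real (card S)) * g S"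
    proof (cases "card S \<le> d")
      case True
      define q where "q = d - card S"
      have q: "Suc d - card S = Suc q" "real (Suc d) - real (card S) = real (Suc q)"
        using True by (auto simp: q_def)
      \<comment> \<open>Here \<open>Suc q\<close> is the exponent of \<open>t\<close>; the identity
        says that the normalised derivative along \<open>t\<close> multiplies the term by this
        exponent.\<close>
      have "Suc e * (Suc (e + q) choose Suc e) = Suc (e + q) * (e + q choose e)"
        using Suc_times_binomial_eq[of "e + q" e] by (simp only: mult.commute)
      also have "\<dots> = Suc q * (Suc (e + q) choose e)"
        using binomial_absorb_comp[of "Suc (e + q)" e] by simp
      finally have "real (Suc e) * real (Suc (e + q) choose Suc e) = real (Suc q) * real (Suc (e + q) choose e)"
        by (metis of_nat_mult)
      then show ?thesis
        using True unfolding g_def q by (simp add: q_def[symmetric] mult_ac del: binomial_Suc_Suc of_nat_Suc)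
    next
      case False
      then show ?thesis by (auto simp: g_def not_le dest: le_antisym)
    qed
  qed
  have "(\<Sum>i\<in>idx X. der_coeff i e * hpoly w t (der_fam i B) (der_lev i e) d * wt w t i)
     = real (Suc e) * hpoly w t B (Suc e) d * t + (\<Sum>x\<in>X. w x * hpoly w t (link B x) e d)"
    unfolding sum_idx[OF X(1)] by (simp add: der_defs wt_def mult.commute)
  also have "\<dots> = (\<Sum>S\<in>B. real (Suc d) * g S)"
    unfolding 1 2 sum.distrib[symmetric] by (intro sum.cong) (auto simp: algebra_simps)
  also have "\<dots> = real (Suc d) * hpoly w t B e (Suc d)"
    by (simp only: sum_distrib_left hpoly_def g_def)
  finally show ?thesis .
qed

lemma Union_der_fam: "\<Union>(der_fam i B) \<subseteq> \<Union>B"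
proof (cases i)
  case (Some x)
  then show ?thesis using Union_link[of B x] by (auto simp: der_defs)
qed (simp add: der_defs)

lemma third_deriv_euler:
  assumes X: "finite X" "\<Union>B \<subseteq> X"
  shows "(\<Sum>l\<in>idx X. third_deriv w t B e d i j l * wt w t l) = real (Suc d) * hessian w t B e (Suc d) i j"
proof -
  have U: "\<Union>(der_fam j (der_fam i B)) \<subseteq> X"
    using Union_der_fam[of j "der_fam i B"] Union_der_fam[of i B] X(2) by (meson order_trans)
  let ?B = "der_fam j (der_fam i B)" and ?e = "der_lev j (der_lev i e)"
  have "(\<Sum>l\<in>idx X. third_deriv w t B e d i j l * wt w t l) = der_coeff i e * der_coeff j (der_lev i e) *
     (\<Sum>l\<in>idx X. der_coeff l ?e * hpoly w t (der_fam l ?B) (der_lev l ?e) d * wt w t l)"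
    unfolding sum_distrib_left third_deriv_def hessian_def by (simp add: mult_ac)
  then show ?thesis unfolding hpoly_euler[OF X(1) U] by (simp add: hessian_def)
qed

lemma hpoly_nonneg:
  assumes "\<And>x. x \<in> \<Union>B \<Longrightarrow> w x > 0" "t \<ge> 0"
  shows "hpoly w t B e d \<ge> 0"
proof -
  have "prod w S \<ge> 0" if "S \<in> B" for S
    using assms(1) that by (intro prod_nonneg) (force simp: less_imp_le)
  then show ?thesis unfolding hpoly_def using assms(2)
    by (intro sum_nonneg mult_nonneg_nonneg) auto
qed

lemma hpoly_pos_iff:
  assumes "finite (\<Union>B)" "\<And>x. x \<in> \<Union>B \<Longrightarrow> w x > 0" "t > 0"
  shows "hpoly w t B e d > 0 \<longleftrightarrow> (\<exists>S\<in>B. card S \<le> d)"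
proof
  assume "hpoly w t B e d > 0"
  then show "\<exists>S\<in>B. card S \<le> d"
    unfolding hpoly_def by (rule contrapos_pp) simp
next
  assume "\<exists>S\<in>B. card S \<le> d"
  then obtain S where S: "S \<in> B" "card S \<le> d" by auto
  have pos: "prod w S > 0" if "S \<in> B" for S
    using assms(2) that by (intro prod_pos) auto
  have "finite B" using assms(1) by (rule finite_UnionD)
  then show "hpoly w t B e d > 0"
    unfolding hpoly_def using assms(3) S pos
    by (intro sum_pos2[of B S]) (auto intro!: mult_nonneg_nonneg less_imp_le[OF pos])
qed

lemma der_coeff_pos: "der_coeff i e > 0"
  by (simp add: der_defs split: option.splits)

lemma third_deriv_nonneg:
  assumes "\<And>x. x \<in> \<Union>B \<Longrightarrow> w x > 0" "t \<ge> 0"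
  shows "third_deriv w t B e d i j l \<ge> 0"
proof -
  have "hpoly w t (der_fam l (der_fam j (der_fam i B))) e' d \<ge> 0" for e'
  proof (rule hpoly_nonneg)
    fix x assume "x \<in> \<Union>(der_fam l (der_fam j (der_fam i B)))"
    then have "x \<in> \<Union>B" by (meson Union_der_fam subsetD)
    then show "w x > 0" by (rule assms(1))
  qed (rule assms(2))
  then show ?thesis
    unfolding third_deriv_def hessian_def by (simp add: less_imp_le[OF der_coeff_pos])
qed

lemma hyperbolic_scale:
  assumes "hyperbolic V H" "c > 0"
  shows "hyperbolic V (\<lambda>i j. c * H i j)"
proof -
  have *: "bilin V (\<lambda>i j. c * H i j) u v = c * bilin V H u v" for u v
    by (simp add: bilin_def sum_distrib_left mult_ac)
  show ?thesis unfolding hyperbolic_def *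
  proof (intro allI impI)
    fix u v assume "0 < c * bilin V H u u"
    then have "bilin V H u u * bilin V H v v \<le> (bilin V H u v)\<^sup>2"
      using assms by (simp add: hyperbolic_def zero_less_mult_iff)
    then have "c\<^sup>2 * (bilin V H u u * bilin V H v v) \<le> c\<^sup>2 * (bilin V H u v)\<^sup>2"
      by (intro mult_left_mono) auto
    then show "c * bilin V H u u * (c * bilin V H v v) \<le> (c * bilin V H u v)\<^sup>2"
      by (simp add: power2_eq_square mult_ac)
  qed
qed

section \<open>Quadratic case\<close>

text \<open>The right-hand side is the sum of the squared class sums of an equivalence relation. By
  Cauchy-Schwarz it is at least the squared total divided by the number of classes, and there are at
  most \<open>card U\<close> classes.\<close>

lemma sum_symmetric_transitive_ge:
  fixes v :: "'a \<Rightarrow> real"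
  assumes fin: "finite U" and N_refl: "\<And>x. x \<in> U \<Longrightarrow> N x x"
    and sym: "\<And>x y. x \<in> U \<Longrightarrow> y \<in> U \<Longrightarrow> N x y \<Longrightarrow> N y x"
    and trans: "\<And>x y z. x \<in> U \<Longrightarrow> y \<in> U \<Longrightarrow> z \<in> U \<Longrightarrow> N x y \<Longrightarrow> N y z \<Longrightarrow> N x z"
    and m: "real (card U) \<le> m" "m > 0"
  shows "(\<Sum>x\<in>U. v x)\<^sup>2 / m \<le> (\<Sum>x\<in>U. \<Sum>y\<in>U. if N x y then v x * v y else 0)"
proof -
  define cl where "cl x = {y\<in>U. N x y}" for x
  \<comment> \<open>Weighting each element by the reciprocal of its class size counts every class
    once, so no set of classes has to be formed.\<close>
  define c where "c x = 1 / real (card (cl x))" for x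
  define s where "s x = sum v (cl x)" for x
  have cl_eq: "cl x = cl y" if "x \<in> U" "y \<in> U" "N x y" for x y
    unfolding cl_def
  proof (intro Collect_cong conj_cong refl iffI)
    fix z assume z: "z \<in> U"
    show "N y z" if "N x z"
      by (rule trans[OF \<open>y \<in> U\<close> \<open>x \<in> U\<close> z sym[OF \<open>x \<in> U\<close> \<open>y \<in> U\<close> \<open>N x y\<close>] that])
    show "N x z" if "N y z"
      by (rule trans[OF \<open>x \<in> U\<close> \<open>y \<in> U\<close> z \<open>N x y\<close> that])
  qed
  have cl_pos: "card (cl x) > 0" if "x \<in> U" for x
    using that fin N_refl by (auto simp: cl_def card_gt_0_iff)
  have key: "(\<Sum>x\<in>U. c x * f (cl x) * s x) = (\<Sum>x\<in>U. f (cl x) * v x)" for f :: "'a set \<Rightarrow> real"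
  proof -
    have "(\<Sum>x\<in>U. c x * f (cl x) * s x) = (\<Sum>x\<in>U. \<Sum>y\<in>U. if N x y then c x * f (cl x) * v y else 0)"
      unfolding s_def sum_distrib_left cl_def using fin by (simp add: sum.inter_filter)
    also have "\<dots> = (\<Sum>y\<in>U. \<Sum>x\<in>U. if N x y then c x * f (cl x) * v y else 0)" by (rule sum.swap)
    also have "\<dots> = (\<Sum>y\<in>U. \<Sum>x\<in>U. if x \<in> cl y then c y * f (cl y) * v y else 0)"
    proof (intro sum.cong refl)
      fix x y assume xy: "x \<in> U" "y \<in> U"
      have "N x y \<longleftrightarrow> x \<in> cl y" using sym xy by (auto simp: cl_def)
      then show "(if N x y then c x * f (cl x) * v y else 0) = (if x \<in> cl y then c y * f (cl y) * v y else 0)"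
        using cl_eq[OF xy] by (auto simp: c_def)
    qed
    also have "\<dots> = (\<Sum>y\<in>U. real (card (cl y)) * (c y * f (cl y) * v y))"
    proof (intro sum.cong refl)
      fix y assume "y \<in> U"
      have "{x\<in>U. x \<in> cl y} = cl y" by (auto simp: cl_def)
      then show "(\<Sum>x\<in>U. if x \<in> cl y then c y * f (cl y) * v y else 0) = real (card (cl y)) * (c y * f (cl y) * v y)"
        using fin by (simp add: sum.inter_filter[symmetric])
    qed
    also have "\<dots> = (\<Sum>y\<in>U. f (cl y) * v y)"
      using cl_pos by (intro sum.cong) (auto simp: c_def)
    finally show ?thesis .
  qed
  define a where "a = (\<Sum>x\<in>U. v x) / m"
  have Q: "(\<Sum>x\<in>U. \<Sum>y\<in>U. if N x y then v x * v y else 0) = (\<Sum>x\<in>U. s x * v x)"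
    unfolding s_def cl_def sum_distrib_right sum.inter_filter[OF fin] by (intro sum.cong refl) auto
  have c1: "0 \<le> c x" "c x \<le> 1" if "x \<in> U" for x
    using cl_pos[OF that] by (auto simp: c_def)
  have "0 \<le> (\<Sum>x\<in>U. c x * (s x - a)\<^sup>2)"
    using c1 by (intro sum_nonneg) auto
  also have "\<dots> = (\<Sum>x\<in>U. c x * s x * s x - 2 * a * (c x * 1 * s x) + a\<^sup>2 * c x)"
    by (intro sum.cong refl) (simp add: power2_eq_square algebra_simps)
  also have "\<dots> = (\<Sum>x\<in>U. c x * s x * s x) - 2 * a * (\<Sum>x\<in>U. c x * 1 * s x) + a\<^sup>2 * (\<Sum>x\<in>U. c x)"
    by (simp only: sum.distrib sum_subtractf sum_distrib_left)
  also have "(\<Sum>x\<in>U. c x * s x * s x) = (\<Sum>x\<in>U. s x * v x)"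
    using key[of "sum v"] by (simp add: s_def)
  also have "(\<Sum>x\<in>U. c x * 1 * s x) = m * a"
    using key[of "\<lambda>_. 1"] m by (simp add: a_def)
  also have "a\<^sup>2 * (\<Sum>x\<in>U. c x) \<le> a\<^sup>2 * m"
  proof (rule mult_left_mono)
    have "(\<Sum>x\<in>U. c x) \<le> (\<Sum>x\<in>U. 1)" using c1 by (intro sum_mono) auto
    then show "(\<Sum>x\<in>U. c x) \<le> m" using m by simp
  qed simp
  finally have "a\<^sup>2 * m \<le> (\<Sum>x\<in>U. s x * v x)" by (simp add: power2_eq_square algebra_simps)
  moreover have "a\<^sup>2 * m = (\<Sum>x\<in>U. v x)\<^sup>2 / m"
    using m by (simp add: a_def power2_eq_square)
  ultimately show ?thesis unfolding Q by simp
qed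

lemma hpoly_0:
  assumes "finite (\<Union>B)"
  shows "hpoly w t B e 0 = (if {} \<in> B then 1 else 0)"
proof -
  have "hpoly w t B e 0 = (\<Sum>S\<in>B. if S = {} then 1 else 0)"
    unfolding hpoly_def
  proof (rule sum.cong[OF refl])
    fix S assume "S \<in> B"
    then have "finite S" using assms by (meson Union_upper finite_subset)
    then show "prod w S * (if card S \<le> 0 then t ^ (0 - card S) * real (e + (0 - card S) choose e) else 0)
        = (if S = {} then 1 else 0)" by auto
  qed
  also have "\<dots> = (if {} \<in> B then 1 else 0)"
    using finite_UnionD[OF assms] by simp
  finally show ?thesis .
qed

lemma hessian_0:
  assumes "finite (\<Union>B)"
  shows "hessian w t B e 0 (Some x) (Some y) = (if x \<noteq> y \<and> {x, y} \<in> B then 1 else 0)"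
    and "hessian w t B e 0 (Some x) None = (if {x} \<in> B then real e + 1 else 0)"
    and "hessian w t B e 0 None None = (if {} \<in> B then (real e + 1) * (real e + 2) else 0)"
proof -
  have fin: "finite (\<Union>(der_fam j (der_fam i B)))" for i j
    using assms Union_der_fam by (meson finite_subset)
  show "hessian w t B e 0 (Some x) (Some y) = (if x \<noteq> y \<and> {x, y} \<in> B then 1 else 0)"
    unfolding hessian_def hpoly_0[OF fin] by (auto simp: der_defs link_def)
  show "hessian w t B e 0 (Some x) None = (if {x} \<in> B then real e + 1 else 0)"
    unfolding hessian_def hpoly_0[OF fin] by (auto simp: der_defs link_def)
  show "hessian w t B e 0 None None = (if {} \<in> B then (real e + 1) * (real e + 2) else 0)"
    unfolding hessian_def hpoly_0[OF fin] by (auto simp: der_defs algebra_simps)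
qed

lemma bilin_hessianian_0:
  assumes X: "finite X" "\<Union>B \<subseteq> X"
  shows "bilin (idx X) (hessian w t B e 0) v v =
      (\<Sum>x\<in>X. \<Sum>y\<in>X. if x \<noteq> y \<and> {x, y} \<in> B then v (Some x) * v (Some y) else 0)
    + 2 * (real e + 1) * v None * (\<Sum>x\<in>{x\<in>X. {x} \<in> B}. v (Some x))
    + (if {} \<in> B then (real e + 1) * (real e + 2) * (v None)\<^sup>2 else 0)"
proof -
  have fB: "finite (\<Union>B)" using X(2,1) by (rule finite_subset)
  let ?H = "hessian w t B e 0" and ?S = "\<Sum>x\<in>{x\<in>X. {x} \<in> B}. v (Some x)"
  have None_Some: "?H None (Some x) = ?H (Some x) None" for x
    by (rule hessian_sym)
  have 1: "(\<Sum>x\<in>X. v (Some x) * (\<Sum>y\<in>X. ?H (Some x) (Some y) * v (Some y)))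
      = (\<Sum>x\<in>X. \<Sum>y\<in>X. if x \<noteq> y \<and> {x, y} \<in> B then v (Some x) * v (Some y) else 0)"
    unfolding sum_distrib_left by (intro sum.cong refl) (auto simp: hessian_0(1)[OF fB])
  have 2: "(\<Sum>x\<in>X. v (Some x) * (?H (Some x) None * v None)) = (real e + 1) * v None * ?S"
    unfolding sum_distrib_left sum.inter_filter[OF X(1)]
    by (intro sum.cong refl) (auto simp: hessian_0(2)[OF fB])
  have 3: "(\<Sum>x\<in>X. ?H None (Some x) * v (Some x)) = (real e + 1) * ?S"
    unfolding sum_distrib_left sum.inter_filter[OF X(1)]
    by (intro sum.cong refl) (auto simp: None_Some hessian_0(2)[OF fB])
  have "bilin (idx X) ?H v v = v None * (?H None None * v None + (\<Sum>x\<in>X. ?H None (Some x) * v (Some x)))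
      + ((\<Sum>x\<in>X. v (Some x) * (?H (Some x) None * v None))
         + (\<Sum>x\<in>X. v (Some x) * (\<Sum>y\<in>X. ?H (Some x) (Some y) * v (Some y))))"
    unfolding bilin_def sum_idx[OF X(1)] by (simp only: distrib_left sum.distrib)
  also have "\<dots> = (\<Sum>x\<in>X. \<Sum>y\<in>X. if x \<noteq> y \<and> {x, y} \<in> B then v (Some x) * v (Some y) else 0)
    + 2 * (real e + 1) * v None * ?S + (v None)\<^sup>2 * ?H None None"
    unfolding 1 2 3 by (simp add: power2_eq_square distrib_left distrib_right)
  finally show ?thesis by (simp add: hessian_0(3)[OF fB] mult.commute)
qed

text \<open>Adjacency becomes a perfect square minus the form of the complementary relation, which
  is an equivalence when the graph is complete multipartite.\<close>

lemma sum_adjacent: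
  fixes v :: "'a \<Rightarrow> real"
  assumes "finite U"
  shows "(\<Sum>x\<in>U. \<Sum>y\<in>U. if x \<noteq> y \<and> {x, y} \<in> B then v x * v y else 0)
    = (\<Sum>x\<in>U. v x)\<^sup>2 - (\<Sum>x\<in>U. \<Sum>y\<in>U. if x = y \<or> {x, y} \<notin> B then v x * v y else 0)"
proof -
  have "(\<Sum>x\<in>U. v x)\<^sup>2 = (\<Sum>x\<in>U. \<Sum>y\<in>U. v x * v y)"
    by (simp add: power2_eq_square sum_product)
  also have "\<dots> = (\<Sum>x\<in>U. \<Sum>y\<in>U. if x \<noteq> y \<and> {x, y} \<in> B then v x * v y else 0)
      + (\<Sum>x\<in>U. \<Sum>y\<in>U. if x = y \<or> {x, y} \<notin> B then v x * v y else 0)"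
    unfolding sum.distrib[symmetric] by (intro sum.cong refl) auto
  finally show ?thesis by simp
qed

text \<open>The cases follow the smallest size occurring in the family: zero, one, or at least two.
  Each time the exchange property makes non-adjacency transitive where it is needed, and the form is
  bounded by a product of two linear functionals.\<close>

lemma hyperbolic_hessian_0:
  assumes B: "exchange_family B" and X: "finite X" "\<Union>B \<subseteq> X" and card: "card (\<Union>B) \<le> e + 2"
  shows "hyperbolic (idx X) (hessian w t B e 0)"
proof -
  define adj where "adj v x y = (if x \<noteq> y \<and> {x, y} \<in> B then v (Some x) * v (Some y) else (0::real))"
    for v :: "'a option \<Rightarrow> real" and x y
  define non where "non v x y = (if x = y \<or> {x, y} \<notin> B then v (Some x) * v (Some y) else (0::real))"
    for v :: "'a option \<Rightarrow> real" and x y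
  define multipartite where "multipartite U \<longleftrightarrow>
    (\<forall>x\<in>U. \<forall>y\<in>U. \<forall>z\<in>U. {x, y} \<notin> B \<longrightarrow> {y, z} \<notin> B \<longrightarrow> x \<noteq> z \<longrightarrow> {x, z} \<notin> B)" for U
  define A where "A = {x\<in>X. {x} \<in> B}"
  have A: "finite A" "A \<subseteq> X" "A \<subseteq> \<Union>B" using X by (auto simp: A_def)
  have restrict: "(\<Sum>x\<in>X. \<Sum>y\<in>X. adj v x y) = (\<Sum>x\<in>U. \<Sum>y\<in>U. adj v x y)"
    if U: "U \<subseteq> X" "\<And>x y. x \<noteq> y \<Longrightarrow> {x, y} \<in> B \<Longrightarrow> x \<in> U" for U v
  proof -
    have U': "y \<in> U" if "x \<noteq> y" "{x, y} \<in> B" for x y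
      using U(2)[of y x] that by (simp add: insert_commute)
    have "(\<Sum>x\<in>X. \<Sum>y\<in>X. adj v x y) = (\<Sum>x\<in>X. \<Sum>y\<in>U. adj v x y)"
      using X U U' by (intro sum.cong refl sum.mono_neutral_right) (auto simp: adj_def)
    also have "\<dots> = (\<Sum>x\<in>U. \<Sum>y\<in>U. adj v x y)"
      using X U by (intro sum.mono_neutral_right) (auto simp: adj_def intro!: sum.neutral)
    finally show ?thesis .
  qed
  have adj_non: "(\<Sum>x\<in>U. \<Sum>y\<in>U. adj v x y) = (\<Sum>x\<in>U. v (Some x))\<^sup>2 - (\<Sum>x\<in>U. \<Sum>y\<in>U. non v x y)"
    if "finite U" for U v
    unfolding adj_def non_def by (rule sum_adjacent[OF that])
  have non_ge: "(\<Sum>x\<in>U. v (Some x))\<^sup>2 / m \<le> (\<Sum>x\<in>U. \<Sum>y\<in>U. non v x y)"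
    if U: "finite U" "real (card U) \<le> m" "m > 0"
      and trans: "multipartite U"
    for U v m
    unfolding non_def
  proof (rule sum_symmetric_transitive_ge[OF U(1) _ _ _ U(2,3)])
    fix x y z
    assume "x \<in> U" "y \<in> U" "z \<in> U" "x = y \<or> {x, y} \<notin> B" "y = z \<or> {y, z} \<notin> B"
    then show "x = z \<or> {x, z} \<notin> B"
      using trans unfolding multipartite_def by blast
  qed (auto simp: insert_commute)
  have non_nonneg: "0 \<le> (\<Sum>x\<in>U. \<Sum>y\<in>U. non v x y)"
    if U: "finite U"
      and trans: "multipartite U"
    for U v
  proof -
    have "0 \<le> (\<Sum>x\<in>U. v (Some x))\<^sup>2 / (real (card U) + 1)" by simp
    also have "\<dots> \<le> (\<Sum>x\<in>U. \<Sum>y\<in>U. non v x y)"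
      by (rule non_ge) (use U trans in auto)
    finally show ?thesis .
  qed
  have Atrans: "multipartite A"
    unfolding multipartite_def
  proof (intro ballI impI notI)
    fix x y z
    assume xyz: "x \<in> A" "y \<in> A" "z \<in> A" "{x, y} \<notin> B" "{y, z} \<notin> B" "x \<noteq> z" "{x, z} \<in> B"
    then have "{y} \<in> B" "card {y} < card {x, z}" by (auto simp: A_def)
    then obtain u where "u \<in> {x, z}" "insert u {y} \<in> B"
      using exchange_family_augment[OF B _ xyz(7)] by metis
    moreover have "{z, y} \<notin> B" using xyz(5) by (simp add: insert_commute)
    ultimately show False using xyz(4) by auto
  qed
  have lin: "(\<Sum>x\<in>U. a * u (Some x) + b * v (Some x)) = a * (\<Sum>x\<in>U. u (Some x)) + b * (\<Sum>x\<in>U. v (Some x))"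
    for U :: "'a set" and u v :: "'a option \<Rightarrow> real" and a b
    by (simp add: sum.distrib sum_distrib_left)
  note Q = bilin_hessianian_0[OF X, of w t e, folded A_def, folded adj_def]
  consider "{} \<in> B" | "{} \<notin> B" "A \<noteq> {}" | "{} \<notin> B" "A = {}" by blast
  then show ?thesis
  proof cases
    case 1
    have supp: "x \<in> A" if "x \<noteq> y" "{x, y} \<in> B" for x y
    proof -
      have "y \<in> {x, y}" "y \<notin> {}" by auto
      from exchange_family_exchange[OF B that(2) 1 this]
      have "{x} \<in> B" using that(1) by cases (auto simp: insert_Diff_if)
      then show ?thesis using X by (auto simp: A_def)
    qed
    \<comment> \<open>\<open>m\<close> bounds the number of classes by the cardinality hypothesis.
      It is also the value for which the bounded form collapses to
      \<open>(m - 1) / m * (s + m * v None)^2\<close>, given the z-entries \<open>m - 1\<close> and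
      \<open>(m - 1) * m\<close>.\<close>
    define m where "m = real e + 2"
    have m: "real (card A) \<le> m" "m > 0"
    proof -
      have "card A \<le> card (\<Union>B)" using A X by (intro card_mono) (auto intro: finite_subset)
      then show "real (card A) \<le> m" using card by (simp add: m_def)
    qed (simp add: m_def)
    let ?L = "\<lambda>v :: 'a option \<Rightarrow> real. (\<Sum>x\<in>A. v (Some x)) + m * v None"
    show ?thesis
    proof (rule hyperbolicI_product[OF hessian_sym, where ?L1.0 = ?L and ?L2.0 = "\<lambda>v. (m - 1) / m * ?L v"])
      fix v :: "'a option \<Rightarrow> real"
      define s where "s = (\<Sum>x\<in>A. v (Some x))"
      have "bilin (idx X) (hessian w t B e 0) v v =
          s\<^sup>2 - (\<Sum>x\<in>A. \<Sum>y\<in>A. non v x y) + 2 * (m - 1) * v None * s + (m - 1) * m * (v None)\<^sup>2"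
        unfolding Q using 1 by (simp add: restrict[OF A(2) supp] adj_non[OF A(1)] m_def s_def) (simp add: algebra_simps)
      also have "\<dots> \<le> s\<^sup>2 - s\<^sup>2 / m + 2 * (m - 1) * v None * s + (m - 1) * m * (v None)\<^sup>2"
        using non_ge[OF A(1) m Atrans, where v=v] by (simp add: s_def)
      also have "\<dots> = (s + m * v None) * ((m - 1) / m * (s + m * v None))"
        using m by (simp add: power2_eq_square field_simps)
      finally show "bilin (idx X) (hessian w t B e 0) v v \<le> ?L v * ((m - 1) / m * ?L v)"
        by (simp add: s_def)
    next
      fix a b and u v :: "'a option \<Rightarrow> real"
      show L: "?L (\<lambda>i. a * u i + b * v i) = a * ?L u + b * ?L v"
        unfolding lin by (simp add: algebra_simps)
      show "(m - 1) / m * ?L (\<lambda>i. a * u i + b * v i) = a * ((m - 1) / m * ?L u) + b * ((m - 1) / m * ?L v)"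
        unfolding L by (simp only: distrib_left mult.left_commute)
    qed
  next
    case 2
    then obtain a where a: "a \<in> A" by auto
    \<comment> \<open>Elements that occur in pairs but not alone. They are pairwise non-adjacent and
      adjacent to all of \<open>A\<close>, so up to a nonpositive term the sum over \<open>A\<close>
      factors out of the form.\<close>
    define L where "L = {x\<in>X. x \<notin> A \<and> (\<exists>y. x \<noteq> y \<and> {x, y} \<in> B)}"
    have L: "finite L" "L \<subseteq> X" "A \<inter> L = {}" using X by (auto simp: L_def)
    have supp: "x \<in> A \<union> L" if "x \<noteq> y" "{x, y} \<in> B" for x y
      using that X by (auto simp: L_def)
    have LL: "{x, y} \<notin> B" if "x \<in> L" "y \<in> L" "x \<noteq> y" for x y
    proof
      assume xy: "{x, y} \<in> B"
      have "{a} \<in> B" "a \<in> {a}" "a \<notin> {x, y}" using a that by (auto simp: A_def L_def)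
      from exchange_family_exchange[OF B this(1) xy this(2,3)] show False
        using that xy X 2 by cases (auto simp: L_def A_def)
    qed
    have AL: "{b, x} \<in> B" if b: "b \<in> A" and x: "x \<in> L" for b x
    proof -
      obtain y where y: "x \<noteq> y" "{x, y} \<in> B" using x by (auto simp: L_def)
      have bB: "{b} \<in> B" and bx: "b \<noteq> x" using b x by (auto simp: A_def L_def)
      show ?thesis
      proof (cases "y = b")
        case True
        then show ?thesis using y by (simp add: insert_commute)
      next
        case False
        have xB: "{x} \<notin> B" using x by (auto simp: A_def L_def)
        have "y \<in> {x, y}" "y \<notin> {b}" using False by auto
        from exchange_family_exchange[OF B y(2) bB this] show ?thesis
        proof cases
          case 1
          then show ?thesis using xB y(1) by (simp add: insert_Diff_if)
        next
          case (2 u)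
          then show ?thesis using y(1) by (simp add: insert_Diff_if)
        qed
      qed
    qed
    have LA: "{x, b} \<in> B" if "b \<in> A" "x \<in> L" for b x
      using AL[OF that] by (simp add: insert_commute)
    let ?a = "\<lambda>v :: 'a option \<Rightarrow> real. \<Sum>x\<in>A. v (Some x)" and ?l = "\<lambda>v :: 'a option \<Rightarrow> real. \<Sum>x\<in>L. v (Some x)"
    show ?thesis
    proof (rule hyperbolicI_product[OF hessian_sym, where ?L1.0 = ?a
          and ?L2.0 = "\<lambda>v. ?a v + 2 * ?l v + 2 * (real e + 1) * v None"])
      fix v :: "'a option \<Rightarrow> real"
      have "(\<Sum>x\<in>X. \<Sum>y\<in>X. adj v x y) = (\<Sum>x\<in>A \<union> L. \<Sum>y\<in>A \<union> L. adj v x y)"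
        by (rule restrict) (use A L supp in auto)
      also have "\<dots> = (\<Sum>x\<in>A. \<Sum>y\<in>A. adj v x y) + (\<Sum>x\<in>A. \<Sum>y\<in>L. adj v x y)
         + ((\<Sum>x\<in>L. \<Sum>y\<in>A. adj v x y) + (\<Sum>x\<in>L. \<Sum>y\<in>L. adj v x y))"
        using A L by (simp add: sum.union_disjoint sum.distrib)
      also have "(\<Sum>x\<in>L. \<Sum>y\<in>L. adj v x y) = 0"
        using LL by (intro sum.neutral ballI) (auto simp: adj_def)
      also have "(\<Sum>x\<in>A. \<Sum>y\<in>L. adj v x y) = ?a v * ?l v"
        unfolding sum_product using AL L(3) by (intro sum.cong refl) (auto simp: adj_def)
      also have "(\<Sum>x\<in>L. \<Sum>y\<in>A. adj v x y) = ?l v * ?a v"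
        unfolding sum_product using LA L(3) by (intro sum.cong refl) (auto simp: adj_def)
      finally have "bilin (idx X) (hessian w t B e 0) v v = (?a v)\<^sup>2 - (\<Sum>x\<in>A. \<Sum>y\<in>A. non v x y)
          + 2 * ?a v * ?l v + 2 * (real e + 1) * v None * ?a v"
        unfolding Q adj_non[OF A(1)] using 2 by simp
      then show "bilin (idx X) (hessian w t B e 0) v v \<le> ?a v * (?a v + 2 * ?l v + 2 * (real e + 1) * v None)"
        using non_nonneg[OF A(1) Atrans, where v=v] by (simp add: power2_eq_square algebra_simps)
    qed (simp_all only: lin distrib_left distrib_right mult_ac add_ac)
  next
    case 3
    \<comment> \<open>Without the empty set and singletons every z-entry vanishes, and the form is
      that of the graph of pairs on its non-isolated vertices.\<close>
    define U where "U = {x\<in>X. \<exists>y. x \<noteq> y \<and> {x, y} \<in> B}"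
    have U: "finite U" "U \<subseteq> X" using X by (auto simp: U_def)
    have supp: "x \<in> U" if "x \<noteq> y" "{x, y} \<in> B" for x y
      using that X by (auto simp: U_def)
    have sing: "{x} \<notin> B" for x using 3 X by (auto simp: A_def)
    have Utrans: "multipartite U"
      unfolding multipartite_def
    proof (intro ballI impI notI)
      fix x y z
      assume xyz: "x \<in> U" "y \<in> U" "z \<in> U" "{x, y} \<notin> B" "{y, z} \<notin> B" "x \<noteq> z" "{x, z} \<in> B"
      obtain u where u: "y \<noteq> u" "{y, u} \<in> B" using xyz by (auto simp: U_def)
      have yx: "{y, x} \<notin> B" and zy: "{z, y} \<notin> B"
        using xyz(4,5) by (simp_all add: insert_commute)
      have "u \<in> {y, u}" "u \<notin> {x, z}" using u(2) yx xyz(5) by auto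
      from exchange_family_exchange[OF B u(2) xyz(7) this] show False
      proof cases
        case 1
        then show False using u(1) xyz(6) by simp
      next
        case (2 a)
        have "{y, u} - {u} = {y}" using u by auto
        then have "{a, y} \<in> B" using 2(3) by simp
        then show False using 2(1) xyz(4) zy by auto
      qed
    qed
    let ?L = "\<lambda>v :: 'a option \<Rightarrow> real. \<Sum>x\<in>U. v (Some x)"
    show ?thesis
    proof (rule hyperbolicI_product[OF hessian_sym, where ?L1.0 = ?L and ?L2.0 = ?L])
      fix v :: "'a option \<Rightarrow> real"
      have "(\<Sum>x\<in>X. \<Sum>y\<in>X. adj v x y) = (\<Sum>x\<in>U. \<Sum>y\<in>U. adj v x y)"
        by (rule restrict[OF U(2)]) (rule supp)
      then show "bilin (idx X) (hessian w t B e 0) v v \<le> ?L v * ?L v"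
        unfolding Q adj_non[OF U(1)]
        using 3 non_nonneg[OF U(1) Utrans, where v=v] by (simp add: power2_eq_square)
    qed (simp_all only: lin)
  qed
qed

section \<open>Hyperbolicity of the Hessian\<close>

lemma exchange_family_der_fam: "exchange_family B \<Longrightarrow> exchange_family (der_fam i B)"
  by (simp add: der_defs exchange_family_link split: option.splits)

text \<open>Invariant of the induction on the degree: a link loses an element or is empty, and a
  derivative along \<open>t\<close> raises \<open>e\<close>. Either pays for the lost
  degree.\<close>

lemma card_Union_der_fam:
  assumes "finite (\<Union>B)" "card (\<Union>B) \<le> e + Suc d"
  shows "card (\<Union>(der_fam i B)) \<le> der_lev i e + d"
proof (cases i)
  case None
  then show ?thesis using assms by (simp add: der_defs)
next
  case (Some x)
  show ?thesis
  proof (cases "x \<in> \<Union>B")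
    case True
    have "card (\<Union>(link B x)) \<le> card (\<Union>B - {x})"
      using assms Union_link[of B x] by (intro card_mono) auto
    then show ?thesis using Some True assms by (simp add: der_defs)
  next
    case False
    then have "link B x = {}" by (auto simp: link_def)
    then show ?thesis using Some by (simp add: der_defs)
  qed
qed

section \<open>Positive entries and connectedness of the Hessian\<close>

lemma hessian_pos_Some_Some:
  assumes B: "exchange_family B" and w: "\<And>x. x \<in> \<Union>B \<Longrightarrow> w x > 0" and t: "t > 0"
    and S: "S \<in> B" "x \<in> S" "y \<in> S" "x \<noteq> y" "card S \<le> d + 2"
  shows "hessian w t B e d (Some x) (Some y) > 0"
proof -
  have C: "exchange_family (link (link B x) y)" using B by (intro exchange_family_link)
  have U: "\<Union>(link (link B x) y) \<subseteq> \<Union>B"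
    using Union_link[of "link B x" y] Union_link[of B x] by auto
  have "S - {x, y} \<in> link (link B x) y"
  proof -
    have "insert x (insert y (S - {x, y})) = S" using S by auto
    then show ?thesis using S by (auto simp: link_def)
  qed
  moreover have "card (S - {x, y}) \<le> d"
    using S exchange_family_finite[OF B S(1)] by (simp add: card_Diff_subset)
  ultimately have "hpoly w t (link (link B x) y) e d > 0"
    using C U w t by (subst hpoly_pos_iff) (auto simp: exchange_family_def)
  then show ?thesis unfolding hessian_def by (simp add: der_defs)
qed

lemma hessian_pos_Some_None:
  assumes B: "exchange_family B" and w: "\<And>x. x \<in> \<Union>B \<Longrightarrow> w x > 0" and t: "t > 0"
    and S: "S \<in> B" "x \<in> S" "card S \<le> d + 1"
  shows "hessian w t B e d (Some x) None > 0"
proof -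
  have C: "exchange_family (link B x)" using B by (intro exchange_family_link)
  have U: "\<Union>(link B x) \<subseteq> \<Union>B" using Union_link[of B x] by auto
  have "S - {x} \<in> link B x" using S by (auto simp: link_def insert_absorb)
  moreover have "card (S - {x}) \<le> d"
    using S exchange_family_finite[OF B S(1)] by simp
  ultimately have "hpoly w t (link B x) (Suc e) d > 0"
    using C U w t by (subst hpoly_pos_iff) (auto simp: exchange_family_def)
  then show ?thesis unfolding hessian_def by (simp add: der_defs)
qed

lemma hessian_pos_imp:
  assumes B: "exchange_family B" and w: "\<And>x. x \<in> \<Union>B \<Longrightarrow> w x > 0" and t: "t > 0"
    and pos: "hessian w t B e d i j > 0"
  shows "\<exists>S\<in>B. card S \<le> (case i of None \<Rightarrow> d + 1 | Some x \<Rightarrow> d + 2) \<and> set_option i \<subseteq> S"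
proof -
  have card: "card (insert x S) \<le> Suc (card S)" for x and S :: "'a set" by (rule card_insert_le_m1) auto
  have C: "exchange_family (der_fam j (der_fam i B))" using B by (intro exchange_family_der_fam)
  have U: "\<Union>(der_fam j (der_fam i B)) \<subseteq> \<Union>B"
    using Union_der_fam[of j "der_fam i B"] Union_der_fam[of i B] by (rule order_trans)
  have "w x > 0" if "x \<in> \<Union>(der_fam j (der_fam i B))" for x
    using w subsetD[OF U that] .
  moreover have "hpoly w t (der_fam j (der_fam i B)) (der_lev j (der_lev i e)) d > 0"
    using pos der_coeff_pos[of i e] der_coeff_pos[of j "der_lev i e"]
    unfolding hessian_def by (meson mult_pos_pos zero_less_mult_pos)
  ultimately obtain S where S: "S \<in> der_fam j (der_fam i B)" "card S \<le> d"
    using C t by (subst (asm) hpoly_pos_iff) (auto simp: exchange_family_def)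
  show ?thesis
  proof (cases i; cases j)
    fix x y assume "i = Some x" "j = Some y"
    then show ?thesis using S card[of y S] card[of x "insert y S"]
      by (intro bexI[of _ "insert x (insert y S)"]) (auto simp: der_defs link_def)
  next
    fix x assume "i = Some x" "j = None"
    then show ?thesis using S card[of x S]
      by (intro bexI[of _ "insert x S"]) (auto simp: der_defs link_def)
  next
    fix x assume "i = None" "j = Some x"
    then show ?thesis using S card[of x S]
      by (intro bexI[of _ "insert x S"]) (auto simp: der_defs link_def)
  next
    assume "i = None" "j = None"
    then show ?thesis using S by (intro bexI[of _ S]) (auto simp: der_defs)
  qed
qed

text \<open>A set of size at most \<open>d + 2\<close> is a clique, and one of size at most
  \<open>d + 1\<close> is also joined to \<open>None\<close>. Distinct sets are linked by one
  exchange. If some set is small, everything is joined to \<open>None\<close>; otherwise all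
  relevant sets have size exactly \<open>d + 2\<close>, and \<open>None\<close> has a zero
  row.\<close>

lemma hessian_connected:
  assumes B: "exchange_family B" "\<Union>B \<subseteq> X" and w: "\<And>x. x \<in> \<Union>B \<Longrightarrow> w x > 0" and t: "t > 0"
    and f: "\<And>i j. i \<in> idx X \<Longrightarrow> j \<in> idx X \<Longrightarrow> hessian w t B e d i j > 0 \<Longrightarrow> f i = f j"
    and i: "hessian w t B e d i i' > 0" and j: "hessian w t B e d j j' > 0"
  shows "f i = f j"
proof -
  have idx: "Some x \<in> idx X" "None \<in> idx X" if "S \<in> B" "x \<in> S" for S x
    using that B(2) by (auto simp: idx_def)
  have clique: "f (Some x) = f (Some y)" if "S \<in> B" "card S \<le> d + 2" "x \<in> S" "y \<in> S" for S x y
  proof (cases "x = y")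
    case False
    show ?thesis
      by (rule f[OF idx(1) idx(1) hessian_pos_Some_Some[OF B(1) w t]]) (use that False in auto)
  qed simp
  have cone: "f (Some x) = f None" if "S \<in> B" "card S \<le> d + 1" "x \<in> S" for S x
    by (rule f[OF idx hessian_pos_Some_None[OF B(1) w t]]) (use that in auto)
  have active: "\<exists>S\<in>B. card S \<le> d + 2 \<and> x \<in> S" if "hessian w t B e d (Some x) k > 0" for x k
    using hessian_pos_imp[OF B(1) w t that] by auto
  have other: "\<exists>s\<in>S. s \<noteq> x" if "card S = d + 2" for S and x :: 'a
  proof (rule ccontr)
    assume "\<not> ?thesis"
    then have "card S \<le> card {x}" by (intro card_mono) auto
    then show False using that by simp
  qed
  have swap_card: "card (insert y (S - {s})) = d + 2" if "S \<in> B" "card S = d + 2" "s \<in> S" "y \<notin> S" for S s y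
    using that exchange_family_finite[OF B(1) that(1)] by simp
  show ?thesis
  proof (cases "\<exists>S\<in>B. card S \<le> d + 1")
    case True
    then obtain S0 where S0: "S0 \<in> B" "card S0 \<le> d + 1" by auto
    have apex: "f (Some x) = f None" if x: "hessian w t B e d (Some x) k > 0" for x k
    proof -
      obtain S where S: "S \<in> B" "card S \<le> d + 2" "x \<in> S" using active[OF x] by auto
      show ?thesis
      proof (cases "card S \<le> d + 1")
        case True
        then show ?thesis using cone S by blast
      next
        case False
        then have card: "card S = d + 2" using S by simp
        show ?thesis
        proof (cases "S \<inter> S0 = {}")
          case False
          then obtain s where "s \<in> S" "s \<in> S0" by auto
          then show ?thesis using clique[OF S(1,2,3)] cone[OF S0] by metis
        next
          case True
          \<comment> \<open>As \<open>d + 2 >= 2\<close>, an element other than \<open>x\<close> can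
            be given up. The result still contains \<open>x\<close> and is either small or meets
            \<open>S0\<close>.\<close>
          obtain s where s: "s \<in> S" "s \<noteq> x" using other[OF card] by auto
          have "s \<notin> S0" using s True by auto
          from exchange_family_exchange[OF B(1) S(1) S0(1) s(1) this] show ?thesis
          proof cases
            case 1
            then show ?thesis using cone[OF 1(2)] card s S(3) by simp
          next
            case (2 y)
            have "f (Some x) = f (Some y)"
              by (rule clique[OF 2(3)]) (use swap_card[OF S(1) card s(1) 2(2)] s S(3) in auto)
            then show ?thesis using cone[OF S0 2(1)] by simp
          qed
        qed
      qed
    qed
    have "f i = f None" using apex i by (cases i) auto
    moreover have "f j = f None" using apex j by (cases j) auto
    ultimately show ?thesis by simp
  next
    case False
    have nNone: False if "hessian w t B e d None k > 0" for k
      using hessian_pos_imp[OF B(1) w t that] False by auto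
    obtain x y where xy: "i = Some x" "j = Some y"
      using i j nNone by (cases i; cases j) auto
    obtain S where S: "S \<in> B" "card S \<le> d + 2" "x \<in> S" using active i xy by metis
    obtain T where T: "T \<in> B" "card T \<le> d + 2" "y \<in> T" using active j xy by metis
    have card: "card S = d + 2" "card T = d + 2" using S T False by force+
    show ?thesis
    proof (cases "S \<inter> T = {}")
      case False
      then obtain s where "s \<in> S" "s \<in> T" by auto
      then show ?thesis using clique[OF S] clique[OF T] xy by metis
    next
      case True
      obtain s where s: "s \<in> S" "s \<noteq> x" using other[OF card(1)] by auto
      have "s \<notin> T" using s True by auto
      from exchange_family_exchange[OF B(1) S(1) T(1) s(1) this] show ?thesis
      proof cases
        case 1
        then show ?thesis using card by simp
      next
        case (2 u)
        have "f (Some x) = f (Some u)"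
          by (rule clique[OF 2(3)]) (use swap_card[OF S(1) card(1) s(1) 2(2)] s S(3) in auto)
        then show ?thesis using clique[OF T 2(1)] xy by simp
      qed
    qed
  qed
qed

text \<open>The local forms are the Hessians of derivatives, one degree lower. Both the family and
  \<open>e\<close> vary in the induction, because derivatives along elements change the former and
  derivatives along \<open>t\<close> the latter.\<close>

lemma hyperbolic_hessian_pos:
  assumes "exchange_family B" "finite X" "\<Union>B \<subseteq> X" "card (\<Union>B) \<le> e + d + 2"
    and "\<And>x. x \<in> X \<Longrightarrow> w x > 0" and "t > 0"
  shows "hyperbolic (idx X) (hessian w t B e d)"
  using assms(1,3,4)
proof (induction d arbitrary: B e)
  case 0
  then show ?case using hyperbolic_hessian_0[OF 0(1) assms(2) 0(2)] by simp
next
  case (Suc d)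
  have w: "w x > 0" if "x \<in> \<Union>B" for x using assms(5) Suc.prems(2) that by auto
  show ?case
  proof (rule hyperbolic_local_to_global[where T = "third_deriv w t B e d" and W = "wt w t" and c = "real (Suc d)"])
    show "finite (idx X)" using assms(2) by (rule finite_idx)
    show "0 \<le> third_deriv w t B e d i j l" for i j l
      using w assms(6) by (intro third_deriv_nonneg) auto
    show "0 < wt w t i" if "i \<in> idx X" for i
      using that assms(5,6) by (auto simp: wt_def idx_def)
    show "(\<Sum>l\<in>idx X. third_deriv w t B e d i j l * wt w t l) = real (Suc d) * hessian w t B e (Suc d) i j" for i j
      by (rule third_deriv_euler[OF assms(2) Suc.prems(2)])
    show "hyperbolic (idx X) (third_deriv w t B e d i)" for i
      unfolding third_deriv_def
    proof (rule hyperbolic_scale[OF _ der_coeff_pos, where H = "hessian w t (der_fam i B) (der_lev i e) d"])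
      show "hyperbolic (idx X) (hessian w t (der_fam i B) (der_lev i e) d)"
      proof (rule Suc.IH)
        show "exchange_family (der_fam i B)" using Suc.prems(1) by (rule exchange_family_der_fam)
        show "\<Union>(der_fam i B) \<subseteq> X" using Union_der_fam Suc.prems(2) by (rule order_trans)
        show "card (\<Union>(der_fam i B)) \<le> der_lev i e + d + 2"
          using card_Union_der_fam[of B e "d + 2" i] Suc.prems by (simp add: exchange_family_def)
      qed
    qed
    show "f i = f j"
      if "\<And>i j. i \<in> idx X \<Longrightarrow> j \<in> idx X \<Longrightarrow> hessian w t B e (Suc d) i j > 0 \<Longrightarrow> f i = f j"
        "hessian w t B e (Suc d) i i' > 0" "hessian w t B e (Suc d) j j' > 0" for f :: "_ \<Rightarrow> real" and i j i' j'
      using hessian_connected[OF Suc.prems(1,2) w assms(6) that] .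
  qed (simp_all add: hessian_sym third_deriv_sym)
qed

lemma hyperbolic_hessian:
  assumes "exchange_family B" "finite X" "\<Union>B \<subseteq> X" "card (\<Union>B) \<le> e + d + 2"
    and "\<And>x. x \<in> X \<Longrightarrow> w x > 0"
  shows "hyperbolic (idx X) (hessian w 0 B e d)"
proof (rule hyperbolic_limit[where H = "\<lambda>t. hessian w t B e d"])
  fix t :: real assume "t > 0"
  then show "hyperbolic (idx X) (hessian w t B e d)"
    by (intro hyperbolic_hessian_pos assms)
next
  have "((\<lambda>t. hpoly w t C c d) \<longlongrightarrow> hpoly w 0 C c d) (at_right 0)" for C c
    unfolding hpoly_def
  proof (intro tendsto_sum tendsto_mult tendsto_const)
    fix S
    show "((\<lambda>t. if card S \<le> d then t ^ (d - card S) * real (c + (d - card S) choose c) else 0) \<longlongrightarrow>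
        (if card S \<le> d then 0 ^ (d - card S) * real (c + (d - card S) choose c) else 0)) (at_right (0::real))"
      by (cases "card S \<le> d") (simp_all, intro tendsto_intros)
  qed
  then show "((\<lambda>t. hessian w t B e d i j) \<longlongrightarrow> hessian w 0 B e d i j) (at_right 0)" for i j
    unfolding hessian_def by (intro tendsto_intros)
qed

section \<open>Equality case\<close>

definition level_sum :: "('a \<Rightarrow> real) \<Rightarrow> 'a set set \<Rightarrow> nat \<Rightarrow> real" where
  "level_sum w B d = (\<Sum>S\<in>{S\<in>B. card S = d}. \<Prod>x\<in>S. w x)"

text \<open>By \<open>0 ^ 0 = 1\<close> exactly the sets of size \<open>d\<close> survive, and their
  binomial coefficient is one, so \<open>e\<close> disappears.\<close>

lemma hpoly_at_0:
  assumes "finite B"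
  shows "hpoly w 0 B e d = level_sum w B d"
  unfolding hpoly_def level_sum_def sum.inter_filter[OF assms]
  by (intro sum.cong refl) auto

lemma level_sum_nonneg:
  assumes "\<forall>x\<in>\<Union>B. w x > 0"
  shows "level_sum w B d \<ge> 0"
  unfolding level_sum_def
proof (rule sum_nonneg)
  fix S assume "S \<in> {S\<in>B. card S = d}"
  then have "\<forall>x\<in>S. w x > 0" using assms by auto
  then show "prod w S \<ge> 0" by (intro prod_nonneg) (auto simp: less_imp_le)
qed

lemma level_sum_pos_iff:
  assumes "finite B" "\<forall>x\<in>\<Union>B. w x > 0"
  shows "level_sum w B d > 0 \<longleftrightarrow> (\<exists>S\<in>B. card S = d)"
proof
  assume "level_sum w B d > 0"
  then show "\<exists>S\<in>B. card S = d"
    unfolding level_sum_def by (rule contrapos_pp) (simp cong: conj_cong)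
next
  assume "\<exists>S\<in>B. card S = d"
  moreover have "prod w S > 0" if "S \<in> {S\<in>B. card S = d}" for S
    using assms(2) that by (intro prod_pos) auto
  ultimately show "level_sum w B d > 0"
    unfolding level_sum_def using assms(1) by (intro sum_pos) auto
qed

lemma level_sum_0_iff:
  assumes "finite B" "\<forall>x\<in>\<Union>B. w x > 0"
  shows "level_sum w B d = 0 \<longleftrightarrow> (\<forall>S\<in>B. card S \<noteq> d)"
proof -
  have "level_sum w B d = 0 \<longleftrightarrow> \<not> level_sum w B d > 0"
    using level_sum_nonneg[of B w d] assms(2) by force
  then show ?thesis using level_sum_pos_iff[OF assms] by simp
qed

definition kernel_vector :: "('a \<Rightarrow> real) \<Rightarrow> real \<Rightarrow> 'a option \<Rightarrow> real" where
  "kernel_vector w l i = (case i of None \<Rightarrow> - l | Some x \<Rightarrow> w x)"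

text \<open>These are the rows of the Hessian at \<open>t = 0\<close> applied to
  \<open>kernel_vector w l\<close>, rewritten by Euler's relation and divided by the positive
  \<open>der_coeff\<close>. In this form they speak only about sums over levels.\<close>

definition balanced :: "('a \<Rightarrow> real) \<Rightarrow> real \<Rightarrow> 'a set \<Rightarrow> 'a set set \<Rightarrow> nat \<Rightarrow> nat \<Rightarrow> bool" where
  "balanced w l X B e d \<longleftrightarrow> (\<forall>i\<in>idx X. real (Suc d) * level_sum w (der_fam i B) (Suc d)
      = l * real (Suc (der_lev i e)) * level_sum w (der_fam i B) d)"

lemma finite_der_fam: "finite (\<Union>B) \<Longrightarrow> finite (der_fam i B)"
  by (meson Union_der_fam finite_UnionD finite_subset)

lemma hessian_row_wt:
  assumes "finite X" "\<Union>B \<subseteq> X"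
  shows "(\<Sum>j\<in>idx X. hessian w t B e d i j * wt w t j)
     = der_coeff i e * (real (Suc d) * hpoly w t (der_fam i B) (der_lev i e) (Suc d))"
proof -
  have "\<Union>(der_fam i B) \<subseteq> X" using Union_der_fam assms(2) by (rule order_trans)
  from hpoly_euler[OF assms(1) this, of "der_lev i e" w t d]
  show ?thesis unfolding hessian_def by (simp add: sum_distrib_left[symmetric] mult.assoc)
qed

lemma hessian_row_kernel_vector:
  assumes X: "finite X" "\<Union>B \<subseteq> X"
  shows "(\<Sum>j\<in>idx X. hessian w 0 B e d i j * kernel_vector w l j)
     = der_coeff i e * (real (Suc d) * level_sum w (der_fam i B) (Suc d)
         - l * real (Suc (der_lev i e)) * level_sum w (der_fam i B) d)"
proof -
  have fB: "finite (\<Union>B)" using X(2,1) by (rule finite_subset)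
  have "(\<Sum>j\<in>idx X. hessian w 0 B e d i j * kernel_vector w l j)
      = (\<Sum>j\<in>idx X. hessian w 0 B e d i j * wt w 0 j) - l * hessian w 0 B e d i None"
    unfolding sum_idx[OF X(1)] by (simp add: kernel_vector_def wt_def)
  also have "hessian w 0 B e d i None = der_coeff i e * (real (Suc (der_lev i e)) * level_sum w (der_fam i B) d)"
    unfolding hessian_def by (simp add: der_fam_def[of None] der_lev_def[of None] der_coeff_def[of None]
        hpoly_at_0[OF finite_der_fam[OF fB]])
  finally show ?thesis
    unfolding hessian_row_wt[OF X] hpoly_at_0[OF finite_der_fam[OF fB]]
    by (simp add: algebra_simps)
qed

lemma balanced_iff_kernel:
  assumes X: "finite X" "\<Union>B \<subseteq> X"
  shows "balanced w l X B e d \<longleftrightarrow> (\<forall>i\<in>idx X. (\<Sum>j\<in>idx X. hessian w 0 B e d i j * kernel_vector w l j) = 0)"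
  unfolding hessian_row_kernel_vector[OF X] balanced_def using der_coeff_pos
  by (metis eq_iff_diff_eq_0 less_numeral_extra(3) mult_eq_0_iff)

text \<open>Kernel descent at the index \<open>Some x\<close>; the set \<open>T\<close> makes the
  form of this link positive at the weight vector.\<close>

lemma balanced_link:
  assumes B: "exchange_family B" and X: "finite X" "\<Union>B \<subseteq> X" and card: "card (\<Union>B) \<le> e + Suc d + 2"
    and w: "\<And>x. x \<in> X \<Longrightarrow> w x > 0" and l: "l > 0"
    and bal: "balanced w l X B e (Suc d)"
    and x: "x \<in> X" and T: "T \<in> link B x" "card T = d + 2"
  shows "balanced w l X (link B x) e d"
proof -
  have finX: "finite (idx X)" using X(1) by (rule finite_idx)
  have link: "\<Union>(link B y) \<subseteq> X" "exchange_family (link B y)" "finite (\<Union>(link B y))"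
    "finite (link B y)" for y
  proof -
    show 1: "\<Union>(link B y) \<subseteq> X" using Union_link[of B y] X(2) by blast
    show 2: "exchange_family (link B y)" using B by (rule exchange_family_link)
    then show "finite (\<Union>(link B y))" by (simp add: exchange_family_def)
    show "finite (link B y)" using 2 by (rule exchange_family_finite_family)
  qed
  have w': "\<forall>z\<in>\<Union>(link B y). w z > 0" for y
    using w link(1)[of y] by blast
  have ker: "(\<Sum>j\<in>idx X. hessian w 0 B e (Suc d) i j * kernel_vector w l j) = 0" if "i \<in> idx X" for i
    using bal that unfolding balanced_iff_kernel[OF X] by blast
  have quad: "bilin (idx X) (third_deriv w 0 B e d (Some y)) (wt w 0) (wt w 0)
      = real (Suc d) * (real (d + 2) * level_sum w (link B y) (d + 2))" if "y \<in> X" for y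
  proof -
    have "bilin (idx X) (third_deriv w 0 B e d (Some y)) (wt w 0) (wt w 0)
       = real (Suc d) * (\<Sum>j\<in>idx X. hessian w 0 B e (Suc d) (Some y) j * wt w 0 j)"
      by (rule bilin_euler) (use that third_deriv_euler[OF X] in \<open>auto simp: idx_def\<close>)
    then show ?thesis unfolding hessian_row_wt[OF X]
      using link(4)[of y] by (simp add: der_defs hpoly_at_0)
  qed
  have "(\<Sum>j\<in>idx X. third_deriv w 0 B e d (Some x) i j * kernel_vector w l j) = 0" if i: "i \<in> idx X" for i
  proof (rule hyperbolic_kernel_descent[where H = "hessian w 0 B e (Suc d)" and W = "wt w 0" and c = "real (Suc d)"
        and V = "idx X" and T = "third_deriv w 0 B e d"])
    show "0 \<le> wt w 0 i" if "i \<in> idx X" for i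
      using that w by (auto simp: wt_def idx_def less_imp_le)
    show "(\<Sum>l\<in>idx X. third_deriv w 0 B e d i j l * wt w 0 l) = real (Suc d) * hessian w 0 B e (Suc d) i j" for i j
      by (rule third_deriv_euler[OF X])
    show "hyperbolic (idx X) (third_deriv w 0 B e d i)" for i
      unfolding third_deriv_def
    proof (rule hyperbolic_scale[OF _ der_coeff_pos, where H = "hessian w 0 (der_fam i B) (der_lev i e) d"])
      show "hyperbolic (idx X) (hessian w 0 (der_fam i B) (der_lev i e) d)"
      proof (rule hyperbolic_hessian)
        show "exchange_family (der_fam i B)" using B by (rule exchange_family_der_fam)
        show "\<Union>(der_fam i B) \<subseteq> X" using Union_der_fam X(2) by (rule order_trans)
        show "card (\<Union>(der_fam i B)) \<le> der_lev i e + d + 2"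
          using card_Union_der_fam[of B e "d + 2" i] B card by (simp add: exchange_family_def)
      qed (use X w in auto)
    qed
    show "bilin (idx X) (third_deriv w 0 B e d (Some x)) (wt w 0) (wt w 0) > 0"
      unfolding quad[OF x] using T level_sum_pos_iff[OF link(4) w', where d = "d + 2"]
      by (intro mult_pos_pos) auto
    show "bilin (idx X) (third_deriv w 0 B e d i) (kernel_vector w l) (kernel_vector w l) \<le> 0"
      if i: "i \<in> idx X" "0 < wt w 0 i" and neg: "bilin (idx X) (third_deriv w 0 B e d i) (wt w 0) (wt w 0) \<le> 0" for i
    proof -
      \<comment> \<open>The index \<open>None\<close> is excluded, since its weight is zero at
        \<open>t = 0\<close>.\<close>
      obtain y where y: "i = Some y" "y \<in> X" using i by (auto simp: idx_def wt_def)
      have "level_sum w (link B y) (d + 2) \<le> 0"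
        using neg unfolding y(1) quad[OF y(2)] by (simp add: mult_le_0_iff del: of_nat_Suc of_nat_add)
      then have "level_sum w (link B y) (d + 2) = 0"
        using level_sum_nonneg[OF w'] by (simp add: order.antisym)
      moreover have "real (Suc (Suc d)) * level_sum w (link B y) (Suc (Suc d))
          = l * real (Suc e) * level_sum w (link B y) (Suc d)"
        using bal y by (auto simp: balanced_def idx_def der_defs)
      ultimately have "level_sum w (link B y) (d + 2) = 0" "level_sum w (link B y) (d + 1) = 0"
        using l by (simp_all del: of_nat_Suc)
      then have none: "card S \<noteq> d + 2" "card S \<noteq> d + 1" if "S \<in> link B y" for S
        using level_sum_0_iff[OF link(4) w'] that by blast+
      \<comment> \<open>Level \<open>d + 2\<close> of the link of \<open>y\<close> is empty by
        assumption and level \<open>d + 1\<close> by balance. A set at level \<open>d\<close> could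
        be augmented from \<open>insert x T\<close> to level \<open>d + 1\<close>. With all three
        levels empty, the whole form at \<open>y\<close> is zero.\<close>
      have none': "card S \<noteq> d" if S: "S \<in> link B y" for S
      proof
        assume card: "card S = d"
        have S': "insert y S \<in> B" "y \<notin> S" using S by (auto simp: link_def)
        have T': "insert x T \<in> B" "x \<notin> T" using T by (auto simp: link_def)
        have fin: "finite S" "finite T"
          using exchange_family_finite[OF B S'(1)] exchange_family_finite[OF B T'(1)] by auto
        then have "card (insert y S) < card (insert x T)" using S' T' T card by simp
        then obtain z where z: "z \<notin> insert y S" "insert z (insert y S) \<in> B"
          using exchange_family_augment[OF B S'(1) T'(1)] by metis
        then have "insert z S \<in> link B y" using S'(2) by (auto simp: link_def insert_commute)
        moreover have "card (insert z S) = d + 1" using z(1) fin card by simp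
        ultimately show False using none by blast
      qed
      have "third_deriv w 0 B e d i j k = 0" for j k
      proof -
        have "level_sum w (der_fam k (der_fam j (link B y))) d = 0"
        proof -
          have "card S \<noteq> d" if S: "S \<in> der_fam k (der_fam j (link B y))" for S
          proof
            assume card: "card S = d"
            have finS: "finite S"
              using exchange_family_finite[OF exchange_family_der_fam[OF exchange_family_der_fam[OF link(2)]] S] .
            show False
            proof (cases k; cases j)
              fix u v assume "k = Some u" "j = Some v"
              then have "insert v (insert u S) \<in> link B y" "u \<notin> S" "v \<notin> insert u S"
                using S by (auto simp: der_defs link_def)
              then show False using none(1)[of "insert v (insert u S)"] card finS by simp
            next
              fix u assume "k = Some u" "j = None"
              then have "insert u S \<in> link B y" "u \<notin> S"
                using S by (auto simp: der_defs link_def)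
              then show False using none(2)[of "insert u S"] card finS by simp
            next
              fix u assume "k = None" "j = Some u"
              then have "insert u S \<in> link B y" "u \<notin> S"
                using S by (auto simp: der_defs link_def)
              then show False using none(2)[of "insert u S"] card finS by simp
            next
              assume "k = None" "j = None"
              then show False using none' S card by (auto simp: der_defs)
            qed
          qed
          then show ?thesis unfolding level_sum_def by (intro sum.neutral) auto
        qed
        moreover have "finite (der_fam k (der_fam j (link B y)))"
          using exchange_family_finite_family[OF exchange_family_der_fam[OF exchange_family_der_fam[OF link(2)]]] .
        ultimately have "hpoly w 0 (der_fam k (der_fam j (link B y))) e' d = 0" for e'
          by (simp add: hpoly_at_0)
        then show ?thesis
          unfolding third_deriv_def hessian_def y(1) by (simp add: der_fam_def[of "Some y"])
      qed
      then show ?thesis by (simp add: bilin_def)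
    qed
  qed (use finX x w i ker in \<open>auto simp: third_deriv_sym idx_def wt_def\<close>)
  then have "(\<Sum>j\<in>idx X. hessian w 0 (link B x) e d i j * kernel_vector w l j) = 0" if "i \<in> idx X" for i
    using that unfolding third_deriv_def by (simp add: der_defs)
  then show ?thesis unfolding balanced_iff_kernel[OF X(1) link(1)] by blast
qed

section \<open>Kernel equations of quadratic forms and their consequences for the family\<close>

lemma level_sum_0:
  assumes "finite (\<Union>B)"
  shows "level_sum w B 0 = (if {} \<in> B then 1 else 0)"
  using hpoly_at_0[OF finite_UnionD[OF assms], of w 0 0] hpoly_0[OF assms, of w 0 0] by simp

lemma level_sum_1:
  assumes "\<Union>B \<subseteq> X"
  shows "level_sum w B 1 = (\<Sum>x\<in>{x\<in>X. {x} \<in> B}. w x)"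
proof -
  have "(\<lambda>x. {x}) ` {x\<in>X. {x} \<in> B} = {S\<in>B. card S = 1}"
    using assms by (auto simp: card_1_singleton_iff)
  then have "level_sum w B 1 = (\<Sum>S\<in>(\<lambda>x. {x}) ` {x\<in>X. {x} \<in> B}. prod w S)"
    by (simp add: level_sum_def)
  also have "\<dots> = (\<Sum>x\<in>{x\<in>X. {x} \<in> B}. w x)"
    by (subst sum.reindex) auto
  finally show ?thesis .
qed

text \<open>Subtracting the equation at \<open>x\<close> from the one at \<open>None\<close> leaves
  \<open>w x\<close> plus the weight of the non-neighbours of \<open>x\<close> equal to
  \<open>l\<close>. So no weight exceeds \<open>l\<close>, while at most \<open>e + 2\<close>
  elements have total weight \<open>l * (e + 2)\<close>. This forces all weights to be
  \<open>l\<close> and leaves no non-neighbours.\<close>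

lemma balanced_0:
  assumes B: "exchange_family B" and X: "finite X" "\<Union>B \<subseteq> X" and card: "card (\<Union>B) \<le> e + 2"
    and w: "\<And>x. x \<in> X \<Longrightarrow> w x > 0" and l: "l > 0" and bal: "balanced w l X B e 0"
    and T: "T \<in> B" "card T = 2"
  obtains V where "V \<subseteq> \<Union>B" "card V = e + 2" "{} \<in> B"
    "\<And>x. x \<in> V \<Longrightarrow> w x = l \<and> {x} \<in> B"
    "\<And>x y. x \<in> V \<Longrightarrow> y \<in> V \<Longrightarrow> x \<noteq> y \<Longrightarrow> {x, y} \<in> B"
proof -
  have fB: "finite (\<Union>B)" using X(2,1) by (rule finite_subset)
  have fl: "finite (\<Union>(link B x))" for x using exchange_family_link[OF B] by (simp add: exchange_family_def)
  have wB: "\<forall>x\<in>\<Union>B. w x > 0" using w X by auto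
  have wl: "\<forall>y\<in>\<Union>(link B x). w y > 0" for x using wB Union_link[of B x] by blast
  have bal_None: "level_sum w B 1 = l * real (e + 2) * level_sum w B 0"
    using bal by (simp add: balanced_def idx_def der_defs)
  have bal_Some: "level_sum w (link B x) 1 = l * real (e + 1) * level_sum w (link B x) 0" if "x \<in> X" for x
    using bal that by (simp add: balanced_def idx_def der_defs)
  define V where "V = {x\<in>X. {x} \<in> B}"
  have V: "finite V" "V \<subseteq> X" "V \<subseteq> \<Union>B" using X by (auto simp: V_def)
  obtain a b where ab: "T = {a, b}" "a \<noteq> b" using T(2) by (meson card_2_iff)
  have aX: "a \<in> X" using ab T X by auto
  \<comment> \<open>The equations carry positivity down one level at a time: a nonzero upper level
    forces a nonzero lower one, so the pair \<open>T\<close> yields a singleton and then the empty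
    set.\<close>
  have "{b} \<in> link B a" using ab T by (auto simp: link_def)
  then have "level_sum w (link B a) 1 > 0"
    by (subst level_sum_pos_iff[OF finite_UnionD[OF fl] wl]) (auto intro!: bexI[of _ "{b}"])
  then have "{} \<in> link B a"
    using bal_Some[OF aX] level_sum_0[OF fl, of w a] by (auto split: if_splits)
  then have "{a} \<in> B" by (simp add: link_def)
  then have "level_sum w B 1 > 0"
    by (subst level_sum_pos_iff[OF finite_UnionD[OF fB] wB]) (auto intro!: bexI[of _ "{a}"])
  then have e: "{} \<in> B"
    using bal_None level_sum_0[OF fB, of w] by (auto split: if_splits)
  then have total: "(\<Sum>x\<in>V. w x) = l * real (e + 2)"
    using bal_None level_sum_0[OF fB, of w] level_sum_1[OF X(2), of w] by (simp add: V_def)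
  have split: "w x + (\<Sum>y\<in>{y\<in>V. y \<noteq> x \<and> {x, y} \<notin> B}. w y) = l" if x: "x \<in> V" for x
  proof -
    have xX: "x \<in> X" and xB: "{x} \<in> B" using x by (auto simp: V_def)
    have "level_sum w (link B x) 1 = l * real (e + 1)"
      using bal_Some[OF xX] level_sum_0[OF fl, of w x] xB by (simp add: link_def)
    moreover have "level_sum w (link B x) 1 = (\<Sum>y\<in>{y\<in>X. {y} \<in> link B x}. w y)"
      by (rule level_sum_1) (use Union_link[of B x] X(2) in blast)
    moreover have "{y\<in>X. {y} \<in> link B x} = {y\<in>V. y \<noteq> x \<and> {x, y} \<in> B}"
    proof -
      have "{y} \<in> B" if y: "x \<noteq> y" "{x, y} \<in> B" for y
      proof -
        have "x \<in> {x, y}" "x \<notin> {}" by auto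
        from exchange_family_exchange[OF B y(2) e this] show ?thesis
          using y(1) by cases (auto simp: insert_Diff_if)
      qed
      then show ?thesis by (auto simp: link_def V_def)
    qed
    ultimately have 1: "(\<Sum>y\<in>{y\<in>V. y \<noteq> x \<and> {x, y} \<in> B}. w y) = l * real (e + 1)" by simp
    have "V = insert x ({y\<in>V. y \<noteq> x \<and> {x, y} \<in> B} \<union> {y\<in>V. y \<noteq> x \<and> {x, y} \<notin> B})"
      using x by auto
    then have "(\<Sum>x\<in>V. w x) = (\<Sum>y\<in>insert x ({y\<in>V. y \<noteq> x \<and> {x, y} \<in> B} \<union> {y\<in>V. y \<noteq> x \<and> {x, y} \<notin> B}). w y)"
      by (rule arg_cong)
    also have "\<dots> = w x + ((\<Sum>y\<in>{y\<in>V. y \<noteq> x \<and> {x, y} \<in> B}. w y) + (\<Sum>y\<in>{y\<in>V. y \<noteq> x \<and> {x, y} \<notin> B}. w y))"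
      using V(1) by (subst sum.insert) (auto intro!: sum.union_disjoint)
    finally show ?thesis using 1 total by (simp add: algebra_simps)
  qed
  have nonadj: "(\<Sum>y\<in>{y\<in>V. y \<noteq> x \<and> {x, y} \<notin> B}. w y) \<ge> 0" for x
    using w V(2) by (intro sum_nonneg) (auto simp: less_imp_le)
  have le: "w x \<le> l" if "x \<in> V" for x using split[OF that] nonadj[of x] by linarith
  have cardV: "card V \<le> e + 2"
    using card_mono[OF fB V(3)] card by simp
  have "(\<Sum>x\<in>V. l - w x) = l * real (card V) - l * real (e + 2)"
    using total by (simp add: sum_subtractf)
  moreover have "l * real (card V) \<le> l * real (e + 2)"
    using l cardV by (intro mult_left_mono) auto
  moreover have "(\<Sum>x\<in>V. l - w x) \<ge> 0" using le by (intro sum_nonneg) auto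
  ultimately have zero: "(\<Sum>x\<in>V. l - w x) = 0" and "l * real (card V) = l * real (e + 2)"
    by linarith+
  then have cV: "card V = e + 2" using l by (metis mult_cancel_left of_nat_eq_iff less_irrefl)
  have wl: "w x = l" if "x \<in> V" for x
    using zero sum_nonneg_eq_0_iff[OF V(1), of "\<lambda>x. l - w x"] le that by auto
  show ?thesis
  proof (rule that[of V])
    show "{x, y} \<in> B" if "x \<in> V" "y \<in> V" "x \<noteq> y" for x y
    proof (rule ccontr)
      assume "{x, y} \<notin> B"
      then have "(\<Sum>y\<in>{y\<in>V. y \<noteq> x \<and> {x, y} \<notin> B}. w y) > 0"
        using that V w by (intro sum_pos2[of _ y]) (auto simp: less_imp_le subset_eq)
      then show False using split[OF that(1)] wl[OF that(1)] by simp
    qed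
    show "w x = l \<and> {x} \<in> B" if "x \<in> V" for x using wl[OF that] that by (auto simp: V_def)
  qed (use V cV e in auto)
qed

text \<open>Links are taken along the elements of \<open>S\<close> until the quadratic case is
  reached; \<open>T\<close> supplies the nonempty top level at each stage.\<close>

lemma balanced_complete:
  assumes "exchange_family B" "finite X" "\<Union>B \<subseteq> X" "card (\<Union>B) \<le> e + d + 2"
    and w: "\<And>x. x \<in> X \<Longrightarrow> w x > 0" and l: "l > 0" and "balanced w l X B e d"
    and "T \<in> B" "card T = d + 2" "S \<subseteq> T" "card S = d"
  shows "\<exists>V. V \<subseteq> \<Union>B - S \<and> card V = e + 2 \<and> S \<in> B \<and> (\<forall>x\<in>V. w x = l \<and> insert x S \<in> B) \<and>
    (\<forall>x\<in>V. \<forall>y\<in>V. x \<noteq> y \<longrightarrow> insert x (insert y S) \<in> B)"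
  using assms(1,3,4,7-)
proof (induction d arbitrary: B S T)
  case 0
  have "finite T" using exchange_family_finite[OF 0(1) 0(5)] .
  then have "finite S" using finite_subset[OF 0(7)] by blast
  then have S: "S = {}" using 0(8) by simp
  obtain V where "V \<subseteq> \<Union>B" "card V = e + 2" "{} \<in> B"
    "\<And>x. x \<in> V \<Longrightarrow> w x = l \<and> {x} \<in> B"
    "\<And>x y. x \<in> V \<Longrightarrow> y \<in> V \<Longrightarrow> x \<noteq> y \<Longrightarrow> {x, y} \<in> B"
    by (rule balanced_0[OF 0(1) assms(2) 0(2) _ w l 0(4) 0(5)]) (use 0(3,6) in simp_all)
  then show ?case unfolding S Diff_empty by (intro exI[of _ V] conjI ballI impI) auto
next
  case (Suc d)
  have finT: "finite T" using exchange_family_finite[OF Suc.prems(1,5)] .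
  obtain x where x: "x \<in> S" using Suc.prems(8) by fastforce
  have finS: "finite S" using Suc.prems(7) finT by (rule finite_subset)
  have xT: "x \<in> T" using x Suc.prems(7) by auto
  then have xX: "x \<in> X" using Suc.prems(2,5) by auto
  have T: "T - {x} \<in> link B x" using Suc.prems(5) xT by (simp add: link_def insert_absorb)
  have cT: "card (T - {x}) = d + 2" using Suc.prems(6) xT finT by simp
  have U: "\<Union>(link B x) \<subseteq> X" using Union_link[of B x] Suc.prems(2) by blast
  have card: "card (\<Union>(link B x)) \<le> e + d + 2"
    using card_Union_der_fam[of B e "d + 2" "Some x"] Suc.prems(1,3)
    by (simp add: exchange_family_def der_defs)
  have bal: "balanced w l X (link B x) e d"
    by (rule balanced_link[OF Suc.prems(1) assms(2) Suc.prems(2) _ w l Suc.prems(4) xX T cT])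
      (use Suc.prems(3) in auto)
  have S: "S - {x} \<subseteq> T - {x}" "card (S - {x}) = d"
    using Suc.prems(7,8) x finS by auto
  from Suc.IH[OF exchange_family_link[OF Suc.prems(1)] U card bal T cT S]
  obtain V where V: "V \<subseteq> \<Union>(link B x) - (S - {x})" "card V = e + 2" "S - {x} \<in> link B x"
    "\<forall>y\<in>V. w y = l \<and> insert y (S - {x}) \<in> link B x"
    "\<forall>y\<in>V. \<forall>z\<in>V. y \<noteq> z \<longrightarrow> insert y (insert z (S - {x})) \<in> link B x"
    by (elim exE conjE)
  have ins: "insert x (insert y (S - {x})) = insert y S" "insert x (insert y (insert z (S - {x}))) = insert y (insert z S)"
    "insert x (S - {x}) = S" for y z
    using x by auto
  have "V \<subseteq> \<Union>B - S" using V(1) Union_link[of B x] by blast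
  moreover have "S \<in> B" "\<forall>y\<in>V. w y = l \<and> insert y S \<in> B"
    using V(3,4) insert_absorb[OF x] by (auto simp: link_def ins)
  moreover have "\<forall>y\<in>V. \<forall>z\<in>V. y \<noteq> z \<longrightarrow> insert y (insert z S) \<in> B"
    using V(5) by (auto simp: link_def ins)
  ultimately show ?case using V(2) by blast
qed

text \<open>On the plane spanned by the weight vector and the unit vector at \<open>None\<close>,
  the form has entries \<open>(d + 1) * (d + 2)\<close>, \<open>(d + 1) * (e + 1)\<close> and
  \<open>(e + 1) * (e + 2)\<close> times the sums of levels \<open>d + 2\<close>,
  \<open>d + 1\<close> and \<open>d\<close>. The assumed equality says that their determinant is
  zero.\<close>

lemma equality_imp_balanced:
  assumes B: "exchange_family B" and X: "finite X" "\<Union>B \<subseteq> X" and card: "card (\<Union>B) \<le> e + d + 2"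
    and w: "\<And>x. x \<in> X \<Longrightarrow> w x > 0"
    and pos: "level_sum w B (d + 1) > 0" "level_sum w B (d + 2) > 0"
    and eq: "real (d + 1) * real (e + 1) * (level_sum w B (d + 1))\<^sup>2
       = real (d + 2) * real (e + 2) * level_sum w B d * level_sum w B (d + 2)"
  obtains l where "l > 0" "balanced w l X B e d"
proof -
  let ?H = "hessian w 0 B e d" and ?W = "wt w 0"
  define z where "z i = (if i = None then 1 else 0 :: real)" for i :: "'a option"
  have fB: "finite B" using B by (rule exchange_family_finite_family)
  have fin: "finite (idx X)" using X(1) by (rule finite_idx)
  have fU: "finite (\<Union>B)" using X(2,1) by (rule finite_subset)
  have row: "bilin (idx X) ?H u ?W = real (Suc d) *
      (\<Sum>i\<in>idx X. der_coeff i e * hpoly w 0 (der_fam i B) (der_lev i e) (Suc d) * u i)" for u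
    unfolding bilin_def hessian_row_wt[OF X] sum_distrib_left by (simp add: mult_ac)
  have WW: "bilin (idx X) ?H ?W ?W = real (d + 1) * real (d + 2) * level_sum w B (d + 2)"
    unfolding row hpoly_euler[OF X] by (simp add: hpoly_at_0[OF fB])
  have z_sum: "(\<Sum>i\<in>idx X. g i * z i) = g None" for g
    unfolding sum_idx[OF X(1)] by (simp add: z_def)
  have zW: "bilin (idx X) ?H z ?W = real (d + 1) * real (e + 1) * level_sum w B (d + 1)"
    unfolding row z_sum by (simp add: der_defs hpoly_at_0[OF fB])
  have "bilin (idx X) ?H z z = ?H None None"
    unfolding bilin_def z_sum by (subst mult.commute) (rule z_sum)
  then have zz: "bilin (idx X) ?H z z = real (e + 1) * real (e + 2) * level_sum w B d"
    by (simp add: hessian_def der_defs hpoly_at_0[OF fB])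
  have Wz: "bilin (idx X) ?H ?W z = bilin (idx X) ?H z ?W"
    by (rule bilin_commute) (rule hessian_sym)
  \<comment> \<open>This choice makes the weight vector minus \<open>l\<close> times
    \<open>z\<close> orthogonal to the weight vector; the zero determinant then makes it a null
    vector.\<close>
  define l where "l = bilin (idx X) ?H ?W ?W / bilin (idx X) ?H z ?W"
  have WWpos: "bilin (idx X) ?H ?W ?W > 0" unfolding WW using pos(2) by (intro mult_pos_pos) auto
  have zWpos: "bilin (idx X) ?H z ?W > 0" unfolding zW using pos(1) by (intro mult_pos_pos) auto
  have l: "l > 0" using WWpos zWpos by (simp add: l_def)
  have "(bilin (idx X) ?H z ?W)\<^sup>2 =
      real (d + 1) * real (e + 1) * (real (d + 1) * real (e + 1) * (level_sum w B (d + 1))\<^sup>2)"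
    unfolding zW by (simp add: power2_eq_square mult_ac)
  also have "\<dots> = bilin (idx X) ?H ?W ?W * bilin (idx X) ?H z z"
    unfolding WW zz eq by (simp only: mult_ac)
  finally have disc: "(bilin (idx X) ?H z ?W)\<^sup>2 = bilin (idx X) ?H ?W ?W * bilin (idx X) ?H z z" .
  have kernel_vector: "kernel_vector w l = (\<lambda>i. 1 * ?W i + (- l) * z i)"
    by (auto simp: kernel_vector_def wt_def z_def split: option.splits)
  have "(\<Sum>j\<in>idx X. ?H i j * kernel_vector w l j) = 0" if "i \<in> idx X" for i
  proof (rule hyperbolic_null_kernel[where H = ?H and p = ?W, OF fin _ _ WWpos _ _ that])
    show "hyperbolic (idx X) ?H" by (rule hyperbolic_hessian[OF B X card w])
    show "bilin (idx X) ?H ?W (kernel_vector w l) = 0"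
      unfolding kernel_vector bilin_right Wz using zWpos by (simp add: l_def)
    have "bilin (idx X) ?H (kernel_vector w l) (kernel_vector w l)
       = bilin (idx X) ?H ?W ?W - 2 * (l * bilin (idx X) ?H z ?W) + l\<^sup>2 * bilin (idx X) ?H z z"
      unfolding kernel_vector bilin_quad[where H = ?H, OF hessian_sym] Wz by simp
    moreover have "l * bilin (idx X) ?H z ?W = bilin (idx X) ?H ?W ?W"
      using zWpos by (simp add: l_def)
    moreover have "l\<^sup>2 * bilin (idx X) ?H z z = bilin (idx X) ?H ?W ?W"
    proof -
      have "bilin (idx X) ?H z z = (bilin (idx X) ?H z ?W)\<^sup>2 / bilin (idx X) ?H ?W ?W"
        using disc WWpos by simp
      then show ?thesis using zWpos WWpos by (simp add: l_def power2_eq_square)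
    qed
    ultimately show "bilin (idx X) ?H (kernel_vector w l) (kernel_vector w l) = 0" by simp
  qed (rule hessian_sym)
  then show ?thesis using that[OF l] balanced_iff_kernel[OF X] by blast
qed

section \<open>Bases of a morphism of matroids\<close>

lemma finite_rank_set: "finite S \<Longrightarrow> finite {card A | A. A \<subseteq> S \<and> A \<in> I}"
  by (rule finite_subset[of _ "card ` Pow S"]) auto

lemma card_le_rank_fun: "finite S \<Longrightarrow> A \<subseteq> S \<Longrightarrow> A \<in> I \<Longrightarrow> card A \<le> rank_fun I S"
  unfolding rank_fun_def by (rule Max_ge[OF finite_rank_set]) auto

lemma rank_fun_witness:
  assumes "{} \<in> I" "finite S"
  obtains A where "A \<subseteq> S" "A \<in> I" "card A = rank_fun I S"
proof -
  have "rank_fun I S \<in> {card A | A. A \<subseteq> S \<and> A \<in> I}"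
    unfolding rank_fun_def by (rule Max_in[OF finite_rank_set]) (use assms in auto)
  then show ?thesis using that by auto
qed

lemma rank_fun_mono:
  assumes "{} \<in> I" "finite T" "S \<subseteq> T"
  shows "rank_fun I S \<le> rank_fun I T"
proof -
  have "finite S" using assms(3,2) by (rule finite_subset)
  from rank_fun_witness[OF assms(1) this] obtain A where "A \<subseteq> S" "A \<in> I" "card A = rank_fun I S" .
  then show ?thesis using card_le_rank_fun[OF assms(2), of A I] assms(3) by auto
qed

lemma rank_fun_le_card:
  assumes "{} \<in> I" "finite S"
  shows "rank_fun I S \<le> card S"
  using rank_fun_witness[OF assms] card_mono[OF assms(2)] by metis

lemma rank_fun_indep:
  assumes "{} \<in> I" "finite S" "S \<in> I"
  shows "rank_fun I S = card S"
  using rank_fun_le_card[OF assms(1,2)] card_le_rank_fun[OF assms(2) _ assms(3)] by auto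

lemma rank_fun_insert_dep:
  assumes "{} \<in> I" "finite S" "insert y S \<notin> I"
  shows "rank_fun I (insert y S) \<le> card S"
proof -
  obtain A where A: "A \<subseteq> insert y S" "A \<in> I" "card A = rank_fun I (insert y S)"
    using rank_fun_witness[OF assms(1), of "insert y S"] assms(2) by auto
  have "A \<subset> insert y S" using A assms(3) by auto
  then have "card A < card (insert y S)" using assms(2) by (intro psubset_card_mono) auto
  also have "\<dots> \<le> Suc (card S)" by (rule card_insert_le_m1) auto
  finally show ?thesis using A(3) by simp
qed

text \<open>Augmentation keeps a full image rank by monotonicity. For the exchange, either the image
  of \<open>S\<close> without \<open>x\<close> still has full rank and the exchange happens in the
  domain, or the new element is found through its image, and the morphism inequality pulls
  independence back.\<close>

lemma exchange_family_morphism_bases: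
  assumes M: "matroid X I" and N: "matroid Y J" and \<Phi>: "matroid_morphism X I Y J \<Phi>"
  shows "exchange_family {S\<in>I. rank_fun J (\<Phi> ` S) = rank_fun J Y}" (is "exchange_family ?B")
proof -
  interpret M: matroid X I by (rule M)
  interpret N: matroid Y J by (rule N)
  have map: "\<Phi> ` S \<subseteq> Y" if "S \<subseteq> X" for S
    using \<Phi> that unfolding matroid_morphism_def by auto
  have finX: "finite S" if "S \<subseteq> X" for S using M.finite_ground that by (rule rev_finite_subset)
  have finY: "finite (\<Phi> ` S)" if "S \<subseteq> X" for S using finX[OF that] by simp
  have rank_le: "rank_fun J (\<Phi> ` S) \<le> rank_fun J Y" if "S \<subseteq> X" for S
    by (rule rank_fun_mono[OF N.indep_empty N.finite_ground map[OF that]])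
  have rank_mono: "rank_fun J (\<Phi> ` S) \<le> rank_fun J (\<Phi> ` T)" if "S \<subseteq> T" "T \<subseteq> X" for S T
    by (rule rank_fun_mono[OF N.indep_empty finY[OF that(2)]]) (use that in auto)
  have morph: "int (rank_fun J (\<Phi> ` T)) - int (rank_fun J (\<Phi> ` S)) \<le> int (rank_fun I T) - int (rank_fun I S)"
    if "S \<subseteq> T" "T \<subseteq> X" for S T
    using \<Phi> that unfolding matroid_morphism_def by auto
  note sub = M.indep_subset_ground
  show ?thesis
    unfolding exchange_family_def
  proof (intro conjI ballI impI)
    have "\<Union>?B \<subseteq> X" using sub by auto
    then show "finite (\<Union>?B)" by (rule finX)
  next
    fix S T assume S: "S \<in> ?B" and T: "T \<in> ?B" and lt: "card S < card T"
    then obtain y where y: "y \<in> T - S" "insert y S \<in> I" using M.indep_augment[of S T] by auto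
    have "rank_fun J (\<Phi> ` S) \<le> rank_fun J (\<Phi> ` insert y S)"
      by (rule rank_mono) (use sub[OF y(2)] in auto)
    then have "rank_fun J (\<Phi> ` insert y S) = rank_fun J Y"
      using rank_le[OF sub[OF y(2)]] S by auto
    then show "\<exists>y\<in>T - S. insert y S \<in> ?B" using y by blast
  next
    fix S T x assume S: "S \<in> ?B" and T: "T \<in> ?B" and x: "x \<in> S - T"
    let ?U = "S - {x}"
    have SX: "S \<subseteq> X" and TX: "T \<subseteq> X" using S T sub by auto
    have finS: "finite S" using SX by (rule finX)
    have U: "?U \<in> I" "?U \<subseteq> X" using M.indep_hereditary[of S ?U] S SX by auto
    have cardU: "card S = Suc (card ?U)" using finS x by (metis DiffD1 card_Suc_Diff1)
    show "card T < card S \<and> ?U \<in> ?B \<or> (\<exists>y\<in>T - S. insert y ?U \<in> ?B)"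
    proof (cases "rank_fun J (\<Phi> ` ?U) = rank_fun J Y")
      case True
      show ?thesis
      proof (cases "card T < card S")
        case False
        \<comment> \<open>If dropping \<open>x\<close> is not allowed by the sizes, \<open>T\<close>
          is larger than \<open>?U\<close> and augments it; \<open>y\<close> differs from
          \<open>x\<close> because \<open>x\<close> is not in \<open>T\<close>.\<close>
        then obtain y where y: "y \<in> T - ?U" "insert y ?U \<in> I"
          using M.indep_augment[of ?U T] U T cardU by auto
        have "rank_fun J (\<Phi> ` ?U) \<le> rank_fun J (\<Phi> ` insert y ?U)"
          by (rule rank_mono) (use sub[OF y(2)] in auto)
        then have "rank_fun J (\<Phi> ` insert y ?U) = rank_fun J Y"
          using rank_le[OF sub[OF y(2)]] True by auto
        then show ?thesis using y x by blast
      qed (use True U in auto)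
    next
      case False
      then have lt: "rank_fun J (\<Phi> ` ?U) < rank_fun J Y" using rank_le[OF U(2)] by simp
      obtain A where A: "A \<subseteq> \<Phi> ` ?U" "A \<in> J" "card A = rank_fun J (\<Phi> ` ?U)"
        using rank_fun_witness[OF N.indep_empty finY[OF U(2)]] .
      obtain C where C: "C \<subseteq> \<Phi> ` T" "C \<in> J" "card C = rank_fun J (\<Phi> ` T)"
        using rank_fun_witness[OF N.indep_empty finY[OF TX]] .
      obtain c where c: "c \<in> C - A" "insert c A \<in> J"
        using N.indep_augment[OF A(2) C(2)] A(3) C(3) lt T by auto
      obtain y where y: "y \<in> T" "c = \<Phi> y" using c C by auto
      have yU: "insert y ?U \<subseteq> X" using y TX U by auto
      have "finite A" using A(1) finY[OF U(2)] by (rule finite_subset)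
      then have "Suc (rank_fun J (\<Phi> ` ?U)) = card (insert c A)" using c A(3) by simp
      also have "\<dots> \<le> rank_fun J (\<Phi> ` insert y ?U)"
        by (rule card_le_rank_fun[OF finY[OF yU] _ c(2)]) (use A y in auto)
      finally have grow: "Suc (rank_fun J (\<Phi> ` ?U)) \<le> rank_fun J (\<Phi> ` insert y ?U)" .
      have yS: "y \<notin> S"
      proof
        assume "y \<in> S"
        then have "insert y ?U = ?U" using x y by auto
        then show False using grow by simp
      qed
      \<comment> \<open>If it were dependent, adding \<open>y\<close> would raise the rank of the
        image but not the rank in the domain.\<close>
      have "insert y ?U \<in> I"
      proof (rule ccontr)
        assume "insert y ?U \<notin> I"
        then have "rank_fun I (insert y ?U) \<le> card ?U"
          using finS by (intro rank_fun_insert_dep M.indep_empty) auto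
        moreover have "rank_fun I ?U = card ?U"
          using finS U by (intro rank_fun_indep M.indep_empty) auto
        ultimately show False using morph[of ?U "insert y ?U"] yU grow by auto
      qed
      \<comment> \<open>Removing \<open>x\<close> costs one in the domain rank, hence at most one in
        the image rank, and \<open>y\<close> regains it.\<close>
      moreover have "rank_fun J (\<Phi> ` insert y ?U) = rank_fun J Y"
      proof -
        have "rank_fun I S = card S" "rank_fun I ?U = card ?U"
          using finS U S by (auto intro!: rank_fun_indep M.indep_empty)
        then have "rank_fun J Y \<le> Suc (rank_fun J (\<Phi> ` ?U))"
          using morph[of ?U S] SX cardU S by auto
        then show ?thesis using grow rank_le[OF yU] by simp
      qed
      ultimately show ?thesis using y yS by blast
    qed
  qed
qed

text \<open>Any two sets of the same size are connected by single swaps, each bringing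
  \<open>T\<close> one element closer to \<open>R\<close>.\<close>

lemma exchange_closed_all:
  assumes X: "finite X" and T: "T \<in> F" "T \<subseteq> X"
    and closed: "\<And>T t y. T \<in> F \<Longrightarrow> T \<subseteq> X \<Longrightarrow> card T = m \<Longrightarrow> t \<in> T \<Longrightarrow> y \<in> X - T \<Longrightarrow> insert y (T - {t}) \<in> F"
    and R: "R \<subseteq> X" "card R = m" and card: "card T = m"
  shows "R \<in> F"
  using T card
proof (induction "card (R - T)" arbitrary: T)
  case 0
  have finR: "finite R" using R(1) X by (rule finite_subset)
  have finT: "finite T" using 0(3) X by (rule finite_subset)
  have "R \<subseteq> T" using 0(1) finR by simp
  then have "R = T" using 0(4) R(2) finT by (intro card_seteq) auto
  then show ?case using 0 by simp
next
  case (Suc k)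
  have finR: "finite R" using R(1) X by (rule finite_subset)
  have finT: "finite T" using Suc.prems(2) X by (rule finite_subset)
  obtain y where y: "y \<in> R - T" using Suc.hyps(2) by (metis card.empty equals0I nat.distinct(1))
  have "\<not> T \<subseteq> R"
  proof
    assume "T \<subseteq> R"
    then have "T = R" using Suc.prems(3) R(2) finR by (intro card_seteq) auto
    then show False using y by simp
  qed
  then obtain t where t: "t \<in> T" "t \<notin> R" by auto
  let ?T = "insert y (T - {t})"
  have "R - T = insert y (R - ?T)" "y \<notin> R - ?T" using y t by auto
  then have "k = card (R - ?T)" using Suc.hyps(2) finR by simp
  moreover have "?T \<in> F" using closed[OF Suc.prems t(1)] y R(1) by auto
  moreover have "?T \<subseteq> X" using y R(1) Suc.prems(2) by auto
  moreover have "card ?T = m"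
    using y finT Suc.prems(3) card_Suc_Diff1[OF finT t(1)] by simp
  ultimately show ?case by (rule Suc.hyps(1))
qed

text \<open>A level attains the binomial count exactly when it contains all subsets of its
  size.\<close>

lemma girth_greater_iff:
  assumes "matroid X I"
  shows "girth X I > enat m \<longleftrightarrow> (\<forall>S. S \<subseteq> X \<longrightarrow> card S \<le> m \<longrightarrow> S \<in> I)"
proof -
  interpret matroid X I by fact
  have sub: "indep_of_size I j \<subseteq> {S. S \<subseteq> X \<and> card S = j}" for j
    using indep_subset_ground by (auto simp: indep_of_size_def)
  have fin: "finite {S. S \<subseteq> X \<and> card S = j}" for j using finite_ground by simp
  have card: "card {S. S \<subseteq> X \<and> card S = j} = card X choose j" for j
    using finite_ground by (rule n_subsets)
  have full: "card (indep_of_size I j) < (card X choose j) \<longleftrightarrow> indep_of_size I j \<noteq> {S. S \<subseteq> X \<and> card S = j}" for j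
    using psubset_card_mono[OF fin, of "indep_of_size I j" j] sub[of j] card[of j] by auto
  show ?thesis
  proof
    assume g: "girth X I > enat m"
    show "\<forall>S. S \<subseteq> X \<longrightarrow> card S \<le> m \<longrightarrow> S \<in> I"
    proof (intro allI impI)
      fix S assume S: "S \<subseteq> X" "card S \<le> m"
      have "\<not> card (indep_of_size I (card S)) < (card X choose card S)"
      proof
        assume "card (indep_of_size I (card S)) < (card X choose card S)"
        then have "girth X I \<le> enat (card S)" unfolding girth_def by (intro Inf_lower) auto
        also have "\<dots> \<le> enat m" using S by simp
        finally show False using g by simp
      qed
      then have "S \<in> indep_of_size I (card S)" unfolding full using S by auto
      then show "S \<in> I" by (simp add: indep_of_size_def)
    qed
  next
    assume all: "\<forall>S. S \<subseteq> X \<longrightarrow> card S \<le> m \<longrightarrow> S \<in> I"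
    have "enat (Suc m) \<le> girth X I"
      unfolding girth_def
    proof (rule Inf_greatest, safe)
      fix j assume "card (indep_of_size I j) < (card X choose j)"
      then have "indep_of_size I j \<noteq> {S. S \<subseteq> X \<and> card S = j}" unfolding full .
      then have "\<not> j \<le> m" using sub[of j] all by (auto simp: indep_of_size_def)
      then show "enat (Suc m) \<le> enat j" by simp
    qed
    then show "girth X I > enat m" using Suc_ile_eq by blast
  qed
qed

theorem theorem1p18:
  fixes X :: "'a set" and I :: "'a set set"
    and Y :: "'b set" and J :: "'b set set"
    and \<Phi> :: "'a \<Rightarrow> 'b" and \<omega> :: "'a \<Rightarrow> real" and n k :: nat
  assumes "matroid X I"
    and "matroid Y J"
    and "n = card X"
    and "matroid_morphism X I Y J \<Phi>"
    and "\<forall>x\<in>X. \<omega> x > 0"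
    and "1 \<le> k" and "k < rank_fun I X"
    and "weighted_bases I Y J \<Phi> \<omega> k > 0"
  shows "(weighted_bases I Y J \<Phi> \<omega> k)\<^sup>2
           = (1 + 1 / real k) * (1 + 1 / (real n - real k))
               * weighted_bases I Y J \<Phi> \<omega> (k - 1) * weighted_bases I Y J \<Phi> \<omega> (k + 1)
         \<longleftrightarrow>
         girth X I > enat (k + 1)
           \<and> (\<exists>c. \<forall>x\<in>X. \<omega> x = c)
           \<and> (\<forall>S\<in>indep_of_size I (k - 1). rank_fun J (\<Phi> ` S) = rank_fun J Y)"
proof -
  interpret M: matroid X I by fact
  interpret N: matroid Y J by fact
  define B where "B = {S\<in>I. rank_fun J (\<Phi> ` S) = rank_fun J Y}"
  have B: "exchange_family B" unfolding B_def by (rule exchange_family_morphism_bases) fact+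
  have UB: "\<Union>B \<subseteq> X" using M.indep_subset_ground by (auto simp: B_def)
  have wb: "weighted_bases I Y J \<Phi> \<omega> j = level_sum \<omega> B j" for j
    unfolding weighted_bases_def level_sum_def
    by (rule sum.cong) (auto simp: morphism_bases_def indep_of_size_def B_def)
  have w: "\<And>x. x \<in> X \<Longrightarrow> \<omega> x > 0" using assms(5) by blast
  have wB: "\<forall>x\<in>\<Union>B. \<omega> x > 0" using w UB by blast
  have fB: "finite B" using B by (rule exchange_family_finite_family)
  obtain d where d: "k = Suc d" using assms(6) by (metis Suc_le_D One_nat_def)
  have kn: "k < n" using assms(7) rank_fun_le_card[OF M.indep_empty M.finite_ground] assms(3) by simp
  \<comment> \<open>The number of derivatives along z that bring the degree from \<open>n\<close>
    down to \<open>k + 1 = d + 2\<close>; the factor \<open>n - k\<close> is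
    \<open>e + 1\<close>.\<close>
  define e where "e = n - k - 1"
  have n: "n = e + d + 2" "real n - real k = real (e + 1)" using kn d by (auto simp: e_def)
  have bk: "level_sum \<omega> B (d + 1) > 0" using assms(8) d by (simp add: wb)
  have E_iff: "(weighted_bases I Y J \<Phi> \<omega> k)\<^sup>2
           = (1 + 1 / real k) * (1 + 1 / (real n - real k))
               * weighted_bases I Y J \<Phi> \<omega> (k - 1) * weighted_bases I Y J \<Phi> \<omega> (k + 1)
      \<longleftrightarrow> (level_sum \<omega> B (d + 1))\<^sup>2
        = (1 + 1 / real (d + 1)) * (1 + 1 / real (e + 1)) * level_sum \<omega> B d * level_sum \<omega> B (d + 2)"
    (is "_ \<longleftrightarrow> ?E")
    unfolding wb n(2) using d by simp
  show ?thesis (is "_ \<longleftrightarrow> ?R")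
    unfolding E_iff
  proof
    assume E: ?E
    have "level_sum \<omega> B (d + 2) \<noteq> 0" using E bk by auto
    then have bk2: "level_sum \<omega> B (d + 2) > 0" using level_sum_nonneg[OF wB, of "d + 2"] by simp
    have E': "real (d + 1) * real (e + 1) * (level_sum \<omega> B (d + 1))\<^sup>2
        = real (d + 2) * real (e + 2) * level_sum \<omega> B d * level_sum \<omega> B (d + 2)"
    proof -
      have "real (d + 1) * (1 + 1 / real (d + 1)) = real (d + 2)" "real (e + 1) * (1 + 1 / real (e + 1)) = real (e + 2)"
        by (simp_all add: field_simps)
      moreover have "real (d + 1) * real (e + 1) * ((1 + 1 / real (d + 1)) * (1 + 1 / real (e + 1)) * p * q)
          = (real (d + 1) * (1 + 1 / real (d + 1))) * (real (e + 1) * (1 + 1 / real (e + 1))) * p * q" for p q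
        by (simp only: mult_ac)
      ultimately show ?thesis unfolding E by simp
    qed
    have card: "card (\<Union>B) \<le> e + d + 2"
      using card_mono[OF M.finite_ground UB] assms(3) n(1) by simp
    obtain l where l: "l > 0" "balanced \<omega> l X B e d"
      by (rule equality_imp_balanced[OF B M.finite_ground UB card _ bk bk2 E']) (auto intro: w)
    have key: "S \<in> B" "x \<in> X - S \<Longrightarrow> \<omega> x = l"
      "x \<in> X - S \<Longrightarrow> y \<in> X - S \<Longrightarrow> x \<noteq> y \<Longrightarrow> insert x (insert y S) \<in> B"
      if T: "T \<in> B" "card T = d + 2" "S \<subseteq> T" "card S = d" for S T x y
    proof -
      obtain V where V: "V \<subseteq> \<Union>B - S" "card V = e + 2" "S \<in> B" "\<forall>x\<in>V. \<omega> x = l \<and> insert x S \<in> B"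
        "\<forall>x\<in>V. \<forall>y\<in>V. x \<noteq> y \<longrightarrow> insert x (insert y S) \<in> B"
      proof -
        have "\<exists>V. V \<subseteq> \<Union>B - S \<and> card V = e + 2 \<and> S \<in> B \<and> (\<forall>x\<in>V. \<omega> x = l \<and> insert x S \<in> B) \<and>
            (\<forall>x\<in>V. \<forall>y\<in>V. x \<noteq> y \<longrightarrow> insert x (insert y S) \<in> B)"
          by (rule balanced_complete[OF B M.finite_ground UB card _ l T]) (rule w)
        then show thesis by (elim exE conjE) (rule that)
      qed
      have SX: "S \<subseteq> X" using V(3) UB by auto
      have "card (X - S) = e + 2"
        using card_Diff_subset[OF finite_subset[OF SX M.finite_ground] SX] T(4) n(1) assms(3) by simp
      moreover have "V \<subseteq> X - S" using V(1) UB by auto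
      \<comment> \<open>The \<open>e + 2\<close> elements found outside \<open>S\<close> exhaust the
        complement, so the local conclusions hold for all of \<open>X - S\<close>.\<close>
      ultimately have VX: "V = X - S" using V(2) M.finite_ground by (intro card_seteq) auto
      show "S \<in> B" by (rule V(3))
      show "\<omega> x = l" if "x \<in> X - S" using V(4) VX that by blast
      show "insert x (insert y S) \<in> B" if "x \<in> X - S" "y \<in> X - S" "x \<noteq> y"
        using V(5) VX that by blast
    qed
    obtain T0 where T0: "T0 \<in> B" "card T0 = d + 2" using bk2 level_sum_pos_iff[OF fB wB] by blast
    have all: "R \<in> B" if R: "R \<subseteq> X" "card R = d + 2" for R
    proof (rule exchange_closed_all[OF M.finite_ground T0(1) _ _ R T0(2)])
      show "T0 \<subseteq> X" using T0 UB by auto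
      fix T t y assume T: "T \<in> B" "T \<subseteq> X" "card T = d + 2" "t \<in> T" "y \<in> X - T"
      have finT: "finite T" using T(2) M.finite_ground by (rule finite_subset)
      then have "card (T - {t}) = d + 1" using T by simp
      then have "T - {t} \<noteq> {}" by (metis Suc_eq_plus1 card.empty nat.distinct(1))
      then obtain s where s: "s \<in> T - {t}" by blast
      \<comment> \<open>Both \<open>s\<close> and \<open>y\<close> lie outside this
        \<open>d\<close>-set, so inserting them performs the swap of \<open>t\<close> for
        \<open>y\<close>.\<close>
      let ?S = "T - {t} - {s}"
      have "card ?S = d" using s T finT by simp
      then have "insert y (insert s ?S) \<in> B"
        by (intro key(3)[OF T(1,3)]) (use T s in auto)
      then show "insert y (T - {t}) \<in> B" using s by (simp add: insert_absorb)
    qed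
    have ext: "\<exists>T\<in>B. S \<subseteq> T \<and> card T = d + 2" if S: "S \<subseteq> X" "card S \<le> d + 2" for S
    proof -
      have "d + 2 \<le> card X" using n(1) assms(3) by simp
      then obtain T where "S \<subseteq> T" "T \<subseteq> X" "card T = d + 2"
        using exists_subset_between[OF S(2) _ S(1) M.finite_ground] by auto
      then show ?thesis using all[of T] by auto
    qed
    have "girth X I > enat (k + 1)"
      unfolding girth_greater_iff[OF assms(1)]
    proof (intro allI impI)
      fix S assume "S \<subseteq> X" "card S \<le> k + 1"
      then obtain T where "T \<in> B" "S \<subseteq> T" using ext[of S] d by auto
      then show "S \<in> I" using M.indep_hereditary[of T S] by (simp add: B_def)
    qed
    moreover have "\<omega> x = l" if x: "x \<in> X" for x
    proof -
      have "d \<le> card (X - {x})" using x n(1) assms(3) M.finite_ground by simp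
      then obtain S where S: "S \<subseteq> X - {x}" "card S = d" by (meson obtain_subset_with_card_n)
      then obtain T where T: "T \<in> B" "card T = d + 2" "S \<subseteq> T" using ext[of S] by auto
      show ?thesis by (rule key(2)[OF T S(2)]) (use S x in auto)
    qed
    moreover have "rank_fun J (\<Phi> ` S) = rank_fun J Y" if "S \<in> indep_of_size I (k - 1)" for S
    proof -
      have S: "S \<subseteq> X" "card S = d" using that M.indep_subset_ground d by (auto simp: indep_of_size_def)
      then obtain T where T: "T \<in> B" "card T = d + 2" "S \<subseteq> T" using ext[of S] by auto
      have "S \<in> B" by (rule key(1)[OF T S(2)])
      then show ?thesis by (simp add: B_def)
    qed
    ultimately show ?R by (intro conjI exI[of _ l] ballI)
  next
    assume R: ?R
    then obtain c where c: "\<And>x. x \<in> X \<Longrightarrow> \<omega> x = c" by blast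
    have ind: "S \<in> I" if "S \<subseteq> X" "card S \<le> d + 2" for S
      using R that d unfolding girth_greater_iff[OF assms(1)] by auto
    have level: "level_sum \<omega> B j = c ^ j * real (n choose j)" if j: "d \<le> j" "j \<le> d + 2" for j
    proof -
      have "{S\<in>B. card S = j} = {S. S \<subseteq> X \<and> card S = j}"
      proof (intro equalityI subsetI)
        fix S assume "S \<in> {S. S \<subseteq> X \<and> card S = j}"
        then have S: "S \<subseteq> X" "card S = j" by auto
        \<comment> \<open>A subset of size \<open>k - 1\<close> already has an image of full rank,
          which monotonicity passes on to \<open>S\<close>.\<close>
        obtain Q where Q: "Q \<subseteq> S" "card Q = d" using obtain_subset_with_card_n[of d S] j S by auto
        have "rank_fun J (\<Phi> ` Q) = rank_fun J Y"
          using R ind[of Q] Q S j d by (auto simp: indep_of_size_def)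
        moreover have "rank_fun J (\<Phi> ` Q) \<le> rank_fun J (\<Phi> ` S)"
          using Q S M.finite_ground by (intro rank_fun_mono N.indep_empty) (auto intro: finite_subset)
        moreover have "rank_fun J (\<Phi> ` S) \<le> rank_fun J Y"
          using assms(4) S by (intro rank_fun_mono N.indep_empty N.finite_ground) (auto simp: matroid_morphism_def)
        ultimately show "S \<in> {S\<in>B. card S = j}" using ind[of S] S j by (auto simp: B_def)
      qed (use UB in auto)
      then have "level_sum \<omega> B j = (\<Sum>S\<in>{S. S \<subseteq> X \<and> card S = j}. c ^ j)"
        unfolding level_sum_def
        by (intro sum.cong) (auto intro!: prod_constant[THEN trans] prod.cong[THEN trans] simp: c subset_eq)
      then show ?thesis using n_subsets[OF M.finite_ground, of j] assms(3) by simp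
    qed
    have step: "real (Suc j) * real (n choose Suc j) = real (n - j) * real (n choose j)" for j
    proof -
      have "Suc j * (n choose Suc j) = (n - j) * (n choose j)"
        using binomial_absorption[of j n] binomial_absorb_comp[of n j] by simp
      then show ?thesis by (metis of_nat_mult)
    qed
    \<comment> \<open>The outer binomials are \<open>(d + 1) / (e + 2)\<close> and
      \<open>(e + 1) / (d + 2)\<close> times the middle one; the product of these ratios is the
      reciprocal of the constant.\<close>
    define b where "b = real (n choose (d + 1))"
    have b0: "real (n choose d) = real (d + 1) * b / real (e + 2)"
      using step[of d] n(1) by (simp add: b_def field_simps)
    have b2: "real (n choose (d + 2)) = real (e + 1) * b / real (d + 2)"
      using step[of "d + 1"] n(1) by (simp add: b_def field_simps)
    have binom: "(1 + 1 / real (d + 1)) * (1 + 1 / real (e + 1)) * real (n choose d) * real (n choose (d + 2)) = b\<^sup>2"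
    proof -
      have *: "1 + 1 / real (d + 1) = real (d + 2) / real (d + 1)" "1 + 1 / real (e + 1) = real (e + 2) / real (e + 1)"
        by (simp_all add: field_simps)
      show ?thesis unfolding b0 b2 * by (simp add: power2_eq_square del: of_nat_Suc of_nat_add)
    qed
    have L: "level_sum \<omega> B d = c ^ d * real (n choose d)" "level_sum \<omega> B (d + 1) = c ^ (d + 1) * b"
      "level_sum \<omega> B (d + 2) = c ^ (d + 2) * real (n choose (d + 2))"
      by (simp_all only: level b_def le_add1 add_le_mono order.refl one_le_numeral)
    have "c ^ d * c ^ (d + 2) = (c ^ (d + 1))\<^sup>2"
      by (simp add: power_add[symmetric] power2_eq_square)
    then have "(c ^ (d + 1) * b)\<^sup>2 = (c ^ d * c ^ (d + 2))
        * ((1 + 1 / real (d + 1)) * (1 + 1 / real (e + 1)) * real (n choose d) * real (n choose (d + 2)))"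
      unfolding binom by (simp only: power_mult_distrib)
    then show ?E unfolding L by (simp only: mult_ac)
  qed
qed

end
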